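(* Let $A$ be a unital ring, $P_A$ a finitely generated projective generator right $A$-module, and $B=\operatorname{End}_A(P)$. (i) If $P$ can be generated by $n$ elements as a right $A$-module, then $\operatorname{sr}(A)\le n\cdot\operatorname{sr}(B)-n+1$. (ii) If there exist $f_1,\dots,f_t\in\operatorname{Hom}_A(P,A)$ such that $\sum_{i=1}^t f_i(P)=A$, then $\operatorname{sr}(B)\le t\cdot\operatorname{sr}(A)-t+1$.
   Context: A row $(a_1,\dots,a_n)\in A^n$ is right unimodular if $\sum_{i=1}^n a_iA=A$. A row $(a_1,\dots,a_n,b)\in A^{n+1}$ is reducible if there exist $c_1,\dots,c_n\in A$ such that $(a_1+bc_1,\dots,a_n+bc_n)$ is right unimodular. The (Bass) stable rank $\operatorname{sr}(A)$ of a unital ring is the least positive integer $n$ such that every right unimodular row in $A^{n+1}$ is reducible, or $\infty$ if no such $n$ exists. *)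

theory Defs
  imports "HOL-Algebra.Ring" "HOL-Library.Extended_Nat"
begin

definition right_unimodular :: "('r, 'm) ring_scheme \<Rightarrow> nat \<Rightarrow> (nat \<Rightarrow> 'r) \<Rightarrow> bool" where
  "right_unimodular R n a \<longleftrightarrow>
     (\<forall>i<n. a i \<in> carrier R) \<and>
     {finsum R (\<lambda>i. a i \<otimes>\<^bsub>R\<^esub> b i) {..<n} | b. \<forall>i<n. b i \<in> carrier R} = carrier R"

text \<open>A row (a_0,...,a_{n-1}, b) of length n+1, with b = a n, is reducible.\<close>
definition reducible_row :: "('r, 'm) ring_scheme \<Rightarrow> nat \<Rightarrow> (nat \<Rightarrow> 'r) \<Rightarrow> bool" where
  "reducible_row R n a \<longleftrightarrow>
     (\<exists>c. (\<forall>i<n. c i \<in> carrier R) \<and>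
          right_unimodular R n (\<lambda>i. a i \<oplus>\<^bsub>R\<^esub> a n \<otimes>\<^bsub>R\<^esub> c i))"

definition sr_cond :: "('r, 'm) ring_scheme \<Rightarrow> nat \<Rightarrow> bool" where
  "sr_cond R n \<longleftrightarrow> (\<forall>a. right_unimodular R (Suc n) a \<longrightarrow> reducible_row R n a)"

definition stable_rank :: "('r, 'm) ring_scheme \<Rightarrow> enat" where
  "stable_rank R = (if \<exists>n\<ge>1. sr_cond R n then enat (LEAST n. n \<ge> 1 \<and> sr_cond R n) else \<infinity>)"

definition type_ring :: "'a::ring_1 ring" where
  "type_ring = \<lparr>carrier = UNIV, mult = (*), one = 1, zero = 0, add = (+)\<rparr>"

definition right_module :: "('p::ab_group_add \<Rightarrow> 'a::ring_1 \<Rightarrow> 'p) \<Rightarrow> bool" where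
  "right_module smul \<longleftrightarrow>
     (\<forall>x y a. smul (x + y) a = smul x a + smul y a) \<and>
     (\<forall>x a b. smul x (a + b) = smul x a + smul x b) \<and>
     (\<forall>x a b. smul x (a * b) = smul (smul x a) b) \<and>
     (\<forall>x. smul x 1 = x)"

definition hom_to_A :: "('p::ab_group_add \<Rightarrow> 'a::ring_1 \<Rightarrow> 'p) \<Rightarrow> ('p \<Rightarrow> 'a) \<Rightarrow> bool" where
  "hom_to_A smul f \<longleftrightarrow> (\<forall>x y. f (x + y) = f x + f y) \<and> (\<forall>x a. f (smul x a) = f x * a)"

definition is_endo :: "('p::ab_group_add \<Rightarrow> 'a::ring_1 \<Rightarrow> 'p) \<Rightarrow> ('p \<Rightarrow> 'p) \<Rightarrow> bool" where
  "is_endo smul f \<longleftrightarrow> (\<forall>x y. f (x + y) = f x + f y) \<and> (\<forall>x a. f (smul x a) = smul (f x) a)"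

definition End_ring :: "('p::ab_group_add \<Rightarrow> 'a::ring_1 \<Rightarrow> 'p) \<Rightarrow> ('p \<Rightarrow> 'p) ring" where
  "End_ring smul = \<lparr>carrier = {f. is_endo smul f}, mult = (\<circ>), one = id,
                    zero = (\<lambda>_. 0), add = (\<lambda>f g x. f x + g x)\<rparr>"

definition free_vecs :: "nat \<Rightarrow> (nat \<Rightarrow> 'a::ring_1) set" where
  "free_vecs m = {v. \<forall>i\<ge>m. v i = 0}"

text \<open>P is finitely generated projective: isomorphic to a direct summand of A^m,
  i.e. there are A-linear maps i : P -> A^m, p : A^m -> P with p o i = id.\<close>
definition fg_projective :: "('p::ab_group_add \<Rightarrow> 'a::ring_1 \<Rightarrow> 'p) \<Rightarrow> bool" where
  "fg_projective smul \<longleftrightarrow>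
     (\<exists>m (\<iota> :: 'p \<Rightarrow> nat \<Rightarrow> 'a) (\<pi> :: (nat \<Rightarrow> 'a) \<Rightarrow> 'p).
        (\<forall>x. \<iota> x \<in> free_vecs m) \<and>
        (\<forall>x y. \<iota> (x + y) = (\<lambda>i. \<iota> x i + \<iota> y i)) \<and>
        (\<forall>x a. \<iota> (smul x a) = (\<lambda>i. \<iota> x i * a)) \<and>
        (\<forall>v\<in>free_vecs m. \<forall>w\<in>free_vecs m. \<pi> (\<lambda>i. v i + w i) = \<pi> v + \<pi> w) \<and>
        (\<forall>v\<in>free_vecs m. \<forall>a. \<pi> (\<lambda>i. v i * a) = smul (\<pi> v) a) \<and>
        (\<forall>x. \<pi> (\<iota> x) = x))"

text \<open>P is a generator: A_A is an epimorphic image of a finite direct sum P^k.\<close>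
definition generator :: "('p::ab_group_add \<Rightarrow> 'a::ring_1 \<Rightarrow> 'p) \<Rightarrow> bool" where
  "generator smul \<longleftrightarrow>
     (\<exists>k (g :: nat \<Rightarrow> 'p \<Rightarrow> 'a). (\<forall>i<k. hom_to_A smul (g i)) \<and>
        (\<forall>a. \<exists>x. a = (\<Sum>i<k. g i (x i))))"

definition generated_by :: "('p::ab_group_add \<Rightarrow> 'a::ring_1 \<Rightarrow> 'p) \<Rightarrow> nat \<Rightarrow> bool" where
  "generated_by smul n \<longleftrightarrow>
     (\<exists>p :: nat \<Rightarrow> 'p. \<forall>x. \<exists>a. x = (\<Sum>i<n. smul (p i) (a i)))"

end

theory Submission
  imports Defs "HOL-Library.Function_Algebras"
begin

text \<open>
  For modules \<open>X\<close>, \<open>Y\<close> let \<open>S(X, Y)\<close> say that whenever \<open>x a + z b = 1\<close> with \<open>x : X \<rightarrow> Y\<close> and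
  \<open>z : Y \<rightarrow> Y\<close>, some \<open>x + z h\<close> is a split epimorphism. Then \<open>sr (End Q) \<le> s\<close> means \<open>S(Q^s, Q)\<close>.
  Row and column operations give \<open>S(Q^s, Q) \<Longrightarrow> S(Q^(s-1+k), Q^k)\<close>; the condition is inherited when
  a common summand is dropped from both arguments, so \<open>S(Q^(s-1) + P, P)\<close> holds for every direct
  summand \<open>P\<close> of some \<open>Q^k\<close>; and it persists when the first argument is enlarged. If \<open>Q\<close> is a direct
  summand of \<open>P^t\<close>, then \<open>P^(t(s-1)+1)\<close> contains \<open>Q^(s-1) + P\<close> as a summand, whence
  \<open>sr (End P) \<le> t(s-1) + 1\<close>. Both parts of the theorem are instances: \<open>A = End(A_A)\<close>, a dual basis
  exhibits \<open>P\<close> as a summand of \<open>A^n\<close>, and the \<open>f_i\<close> exhibit \<open>A\<close> as a summand of \<open>P^t\<close>.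
\<close>

section \<open>Substitution in corners of a ring\<close>

text \<open>The right-nested companion of an equation: once products are associated to the right, a
  rewrite rule for \<open>a * b\<close> fires inside a longer word only in this form.\<close>

lemma mult_eq_assoc: "a * b = c \<Longrightarrow> a * (b * t) = c * t" for a b c t :: "'r::ring"
  by (simp flip: mult.assoc)

locale subring_set =
  fixes E :: "'r::ring set"
  assumes mult_closed: "x \<in> E \<Longrightarrow> y \<in> E \<Longrightarrow> x * y \<in> E"
    and add_closed: "x \<in> E \<Longrightarrow> y \<in> E \<Longrightarrow> x + y \<in> E"
    and diff_closed: "x \<in> E \<Longrightarrow> y \<in> E \<Longrightarrow> x - y \<in> E"
begin

definition Hom :: "'r \<Rightarrow> 'r \<Rightarrow> 'r set" where
  "Hom p q = {x \<in> E. q * x = x \<and> x * p = x}"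

text \<open>
  For idempotents \<open>p\<close>, \<open>q\<close> the corner \<open>Hom p q\<close> plays the role of the maps between the
  direct summands cut out by \<open>p\<close> and \<open>q\<close>; \<open>substitutive p q\<close> is \<open>S(X, Y)\<close>.
\<close>

definition unimodular_pair :: "'r \<Rightarrow> 'r \<Rightarrow> 'r \<Rightarrow> 'r \<Rightarrow> bool" where
  "unimodular_pair p q x z \<longleftrightarrow> (\<exists>a\<in>Hom q p. \<exists>b\<in>Hom q q. x * a + z * b = q)"

definition reducible_pair :: "'r \<Rightarrow> 'r \<Rightarrow> 'r \<Rightarrow> 'r \<Rightarrow> bool" where
  "reducible_pair p q x z \<longleftrightarrow> (\<exists>h\<in>Hom p q. \<exists>y\<in>Hom q p. (x + z * h) * y = q)"

definition substitutive :: "'r \<Rightarrow> 'r \<Rightarrow> bool" where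
  "substitutive p q \<longleftrightarrow>
     (\<forall>x\<in>Hom p q. \<forall>z\<in>Hom q q. unimodular_pair p q x z \<longrightarrow> reducible_pair p q x z)"

lemma Hom_mult: "x \<in> Hom q r \<Longrightarrow> y \<in> Hom p q \<Longrightarrow> x * y \<in> Hom p r"
  by (simp add: Hom_def mult_closed) (metis mult.assoc)

lemma Hom_add: "x \<in> Hom p q \<Longrightarrow> y \<in> Hom p q \<Longrightarrow> x + y \<in> Hom p q"
  by (auto simp: Hom_def add_closed algebra_simps)

lemma Hom_diff: "x \<in> Hom p q \<Longrightarrow> y \<in> Hom p q \<Longrightarrow> x - y \<in> Hom p q"
  by (auto simp: Hom_def diff_closed algebra_simps)

lemma HomD:
  assumes "x \<in> Hom p q"
  shows "q * x = x" "x * p = x" "q * (x * t) = x * t" "x * (p * t) = x * t"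
  using assms by (auto simp: Hom_def simp flip: mult.assoc)

lemma Hom_orth:
  assumes "x \<in> Hom p q"
  shows "p * r = 0 \<Longrightarrow> x * r = 0" "r * q = 0 \<Longrightarrow> r * x = 0"
  by (metis HomD(4)[OF assms] mult_zero_right) (metis HomD(1)[OF assms] mult.assoc mult_zero_left)

lemma Hom_absorb:
  assumes "x \<in> Hom p q"
  shows "p * r = p \<Longrightarrow> x * r = x" "r * q = q \<Longrightarrow> r * x = x"
  by (metis HomD(2,4)[OF assms]) (metis HomD(1)[OF assms] mult.assoc)

section \<open>Elementary operations on unimodular and reducible pairs\<close>

lemma unimodular_pair_add:
  assumes h: "h \<in> Hom p q" and um: "unimodular_pair p q x z"
  shows "unimodular_pair p q (x + z * h) z"
proof -
  obtain a b where ab: "a \<in> Hom q p" "b \<in> Hom q q" "x * a + z * b = q"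
    using um by (auto simp: unimodular_pair_def)
  have "(x + z * h) * a + z * (b - h * a) = q"
    using ab(3) by (simp add: algebra_simps)
  then show ?thesis
    unfolding unimodular_pair_def using ab h by (metis Hom_diff Hom_mult)
qed

lemma reducible_pair_add:
  assumes h: "h \<in> Hom p q" and "reducible_pair p q (x + z * h) z"
  shows "reducible_pair p q x z"
proof -
  obtain k y where ky: "k \<in> Hom p q" "y \<in> Hom q p" "(x + z * h + z * k) * y = q"
    using assms by (auto simp: reducible_pair_def)
  then have "(x + z * (h + k)) * y = q" by (simp add: algebra_simps)
  then show ?thesis
    unfolding reducible_pair_def using ky h by (metis Hom_add)
qed

text \<open>As \<open>t * t = 0\<close>, composition with 1 + t is invertible with inverse 1 - t, so
  the coefficient \<open>a\<close> becomes \<open>a - t * a\<close>. The products are written out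
  because the type class \<open>ring\<close> provides no unit.\<close>

lemma unimodular_pair_shear:
  assumes t: "t \<in> Hom p p" "t * t = 0"
    and um: "unimodular_pair p q x z"
  shows "unimodular_pair p q (x + x * t) z"
proof -
  obtain a b where ab: "a \<in> Hom q p" "b \<in> Hom q q" "x * a + z * b = q"
    using um by (auto simp: unimodular_pair_def)
  have "(x + x * t) * (a - t * a) + z * b = q"
    using ab(3) by (simp add: algebra_simps mult_eq_assoc[OF t(2)])
  then show ?thesis
    unfolding unimodular_pair_def using ab t by (metis Hom_diff Hom_mult)
qed

text \<open>The column operation is undone by composing the perturbation \<open>k\<close> with 1 - t
  and the right inverse \<open>y\<close> with 1 + t.\<close>

lemma reducible_pair_shear:
  assumes t: "t \<in> Hom p p" "t * t = 0"
    and red: "reducible_pair p q (x + x * t) z"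
  shows "reducible_pair p q x z"
proof -
  obtain k y where ky: "k \<in> Hom p q" "y \<in> Hom q p" "(x + x * t + z * k) * y = q"
    using red by (auto simp: reducible_pair_def)
  then have "(x + z * (k - k * t)) * (y + t * y) = q"
    by (simp add: algebra_simps mult_eq_assoc[OF t(2)])
  then show ?thesis
    unfolding reducible_pair_def using ky t by (metis Hom_diff Hom_add Hom_mult)
qed

text \<open>Both arguments grow by isomorphic summands \<open>e'\<close> and \<open>e\<close>.
  Operations on \<open>x\<close> produce the pivot \<open>u\<close> from \<open>e'\<close> to
  \<open>e\<close>, after which only the complementary corners of \<open>S2\<close> remain. The
  summand \<open>n\<close>, orthogonal to \<open>e'\<close>, is where \<open>S1\<close> makes the
  \<open>e\<close>-row right invertible.\<close>

lemma substitutive_step: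
  assumes E: "p \<in> Hom p p" "q \<in> Hom q q" "n \<in> Hom p p" "e' \<in> Hom p p" "e \<in> Hom q q"
    and idem: "n * n = n" "e' * e' = e'" "e * e = e"
    and orth: "n * e' = 0" "e' * n = 0"
    and uv: "u \<in> Hom e' e" "v \<in> Hom e e'" "u * v = e" "v * u = e'"
    and S1: "substitutive n e"
    and S2: "substitutive (p - e') (q - e)"
  shows "substitutive p q"
  unfolding substitutive_def
proof (intro ballI impI)
  fix x z
  assume x: "x \<in> Hom p q" and z: "z \<in> Hom q q" and um: "unimodular_pair p q x z"
  \<comment> \<open>The list \<open>rel\<close> and its extensions form a rewrite system for words
    in these elements; together with \<open>algebra_simps\<close> it proves the corner identities
    below.\<close>
  note rel = idem orth uv(3,4) HomD[OF E(1)] HomD[OF E(2)] HomD[OF E(3)] HomD[OF E(4)]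
    HomD[OF E(5)] HomD[OF uv(1)] HomD[OF uv(2)] HomD[OF z]
    idem[THEN mult_eq_assoc] orth[THEN mult_eq_assoc] uv(3,4)[THEN mult_eq_assoc]
  have EE: "p \<in> E" "q \<in> E" "n \<in> E" "e' \<in> E" "e \<in> E" "u \<in> E" "v \<in> E" "z \<in> E"
    using E uv z by (auto simp: Hom_def)
  note cl = EE mult_closed add_closed diff_closed
  have nv: "n * v = 0" "u * n = 0"
    using Hom_orth[OF uv(1)] Hom_orth[OF uv(2)] orth by auto
  note rel = rel nv nv[THEN mult_eq_assoc]
  have pv: "p * v = v" "u * p = u" "q * u = u" "v * q = v"
    using rel by (metis HomD)+
  note rel = rel pv pv[THEN mult_eq_assoc]


  txt \<open>Once the \<open>e\<close>-row of \<open>x\<close> is an isomorphism on \<open>e'\<close>, block triangular elimination reduces to \<open>S2\<close>.\<close>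
  have clear_row: "reducible_pair p q x z"
    if x: "x \<in> Hom p q" and ex: "e * x = u" and um: "unimodular_pair p q x z" for x
  proof -
    have xE: "x \<in> E" using x by (simp add: Hom_def)
    obtain a b where ab: "a \<in> Hom q p" "b \<in> Hom q q" "x * a + z * b = q"
      using um by (auto simp: unimodular_pair_def)
    have abE: "a \<in> E" "b \<in> E" using ab by (auto simp: Hom_def)
    have vx: "v * x = e'" using HomD(4)[OF uv(2), of x] by (simp add: ex rel)
    note rel' = rel ex vx mult_eq_assoc[OF ex] mult_eq_assoc[OF vx] HomD[OF x] HomD[OF ab(1)] HomD[OF ab(2)]
    note cl' = cl xE abE
    \<comment> \<open>The row operation that uses the pivot row to clear column \<open>e'\<close>:
      \<open>\<beta> * x = X + u\<close>. Since \<open>x * v - e\<close> has square zero,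
      \<open>\<beta>\<close> is invertible in the corner of \<open>q\<close>, with inverse
      \<open>\<beta>'\<close> below.\<close>
    define \<beta> where "\<beta> = q - x * v + e"
    define X where "X = x - x * e'"
    \<comment> \<open>The corner at \<open>q - e\<close> of \<open>\<beta> * z * b\<close>. With
      \<open>b\<close> included, \<open>q - e\<close> itself serves as coefficient of
      \<open>Z\<close>, and the final perturbation becomes \<open>b * h\<close>.\<close>
    define Z where "Z = \<beta> * z * b * (q - e) - e * z * b * (q - e)"
    have X: "X \<in> Hom (p - e') (q - e)"
      unfolding X_def Hom_def by (simp add: cl' rel' algebra_simps)
    have Z: "Z \<in> Hom (q - e) (q - e)"
      unfolding Z_def Hom_def \<beta>_def by (simp add: cl' rel' algebra_simps)
    have "(\<beta> - e) * (x * a + z * b) * (q - e) = q - e"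
      unfolding ab(3) \<beta>_def by (simp add: rel' algebra_simps)
    then have "X * ((p - e') * a * (q - e)) + Z * (q - e) = q - e"
      unfolding X_def Z_def \<beta>_def by (simp add: rel' algebra_simps)
    then have "unimodular_pair (p - e') (q - e) X Z"
      unfolding unimodular_pair_def
      by (intro bexI[of _ "(p - e') * a * (q - e)"] bexI[of _ "q - e"])
        (simp_all add: Hom_def cl' rel' algebra_simps)
    then obtain h y where h: "h \<in> Hom (p - e') (q - e)" and y: "y \<in> Hom (q - e) (p - e')"
      and hy: "(X + Z * h) * y = q - e"
      using S2 X Z unfolding substitutive_def reducible_pair_def by blast
    have hyE: "h \<in> E" "y \<in> E" using h y by (auto simp: Hom_def)
    have h0: "h * v = 0" "e' * y = 0" "e * h = 0" "y * e = 0"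
      using Hom_orth[OF h] Hom_orth[OF y] by (simp_all add: rel algebra_simps)
    have uy: "u * y = 0"
      using HomD(4)[OF uv(1), of y] by (simp add: h0)
    have hp: "q * h = h" "h * p = h" "p * y = y" "y * q = y"
      using Hom_absorb[OF h] Hom_absorb[OF y] by (simp_all add: rel algebra_simps)
    note rel'' = rel' h0 h0[THEN mult_eq_assoc] uy mult_eq_assoc[OF uy] hp hp[THEN mult_eq_assoc]
    \<comment> \<open>Here \<open>y\<close> handles \<open>q - e\<close> and \<open>v\<close>
      handles \<open>e\<close>; the last term cancels the entry \<open>e * z * b * h * y\<close>
      that the perturbation leaves in row \<open>e\<close>.\<close>
    define y' where "y' = y + v - v * z * b * h * y"
    define \<beta>' where "\<beta>' = q + x * v - e"
    have inv: "\<beta>' * \<beta> = q" unfolding \<beta>_def \<beta>'_def by (simp add: rel'' algebra_simps)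
    have "\<beta> * (x + z * (b * h)) * y' = q"
      using hy unfolding \<beta>_def y'_def X_def Z_def by (simp add: rel'' algebra_simps)
    \<comment> \<open>Multiplying by \<open>\<beta>'\<close> on the left and \<open>\<beta>\<close>
      on the right removes the row operation and turns \<open>y' * \<beta>\<close> into the right
      inverse.\<close>
    then have "\<beta>' * (\<beta> * (x + z * (b * h)) * y') * \<beta> = \<beta>' * q * \<beta>" by simp
    moreover have "\<beta>' * (\<beta> * (x + z * (b * h)) * y') * \<beta> = (\<beta>' * \<beta>) * ((x + z * (b * h)) * (y' * \<beta>))"
      by (simp add: mult.assoc)
    moreover have "\<beta>' * q * \<beta> = q" unfolding \<beta>_def \<beta>'_def by (simp add: rel'' algebra_simps)
    moreover have "q * ((x + z * (b * h)) * (y' * \<beta>)) = (x + z * (b * h)) * (y' * \<beta>)"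
      by (simp add: rel'' distrib_right distrib_left mult.assoc)
    ultimately have "(x + z * (b * h)) * (y' * \<beta>) = q" by (simp add: inv)
    then show ?thesis
      unfolding reducible_pair_def
      by (intro bexI[of _ "b * h"] bexI[of _ "y' * \<beta>"])
        (simp_all add: Hom_def cl' hyE rel'' y'_def \<beta>_def algebra_simps)
  qed

  txt \<open>
    \<open>S1\<close> makes the \<open>n\<close>-part of the \<open>e\<close>-row right invertible (\<open>x1\<close>); a column operation then puts the
    isomorphism \<open>u\<close> into column \<open>e'\<close> (\<open>x2\<close>), and another one clears the rest of that row (\<open>x3\<close>).
    Using a column outside \<open>n\<close> avoids any cancellation argument for complements.
  \<close>
  have xE: "x \<in> E" using x by (simp add: Hom_def)
  obtain a b where ab: "a \<in> Hom q p" "b \<in> Hom q q" "x * a + z * b = q"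
    using um by (auto simp: unimodular_pair_def)
  have abE: "a \<in> E" "b \<in> E" using ab by (auto simp: Hom_def)
  note rel' = rel HomD[OF x] HomD[OF ab(1)] HomD[OF ab(2)]
  note cl' = cl xE abE
  \<comment> \<open>The part of the \<open>e\<close>-corner of \<open>x * a + z * b\<close> that
    does not pass through \<open>n\<close>; it takes the place of \<open>z\<close> in
    \<open>S1\<close>.\<close>
  define z1 where "z1 = e * x * (p - n) * a * e + e * z * b * e"
  have "e * x * n * (n * a * e) + z1 * e = e * (x * a + z * b) * e"
    unfolding z1_def by (simp add: rel' algebra_simps)
  also have "\<dots> = e" unfolding ab(3) by (simp add: rel)
  finally have "unimodular_pair n e (e * x * n) z1"
    unfolding unimodular_pair_def
    by (intro bexI[of _ "n * a * e"] bexI[of _ e])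
      (simp_all add: Hom_def cl' rel' algebra_simps)
  moreover have "e * x * n \<in> Hom n e" "z1 \<in> Hom e e"
    by (simp_all add: Hom_def z1_def cl' rel' algebra_simps)
  ultimately obtain h c where h: "h \<in> Hom n e" and c: "c \<in> Hom e n"
    and hc: "(e * x * n + z1 * h) * c = e"
    using S1 unfolding substitutive_def reducible_pair_def by blast
  have hcE: "h \<in> E" "c \<in> E" using h c by (auto simp: Hom_def)
  have hp: "q * h = h" "h * p = h" "p * c = c" "c * q = c" "e' * c = 0"
    using Hom_absorb[OF h] Hom_absorb[OF c] Hom_orth[OF c] by (simp_all add: rel)
  have uc: "u * c = 0" using HomD(4)[OF uv(1), of c] by (simp add: hp)
  note rel'' = rel' HomD[OF h] HomD[OF c] hp hp[THEN mult_eq_assoc] uc mult_eq_assoc[OF uc]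
  \<comment> \<open>Adds columns outside \<open>n\<close> to those in \<open>n\<close>. Together
    with \<open>z * (b * h)\<close> this turns the \<open>n\<close>-part of row \<open>e\<close>
    into \<open>e * x * n + z1 * h\<close>, which has the right inverse \<open>c\<close>.\<close>
  define t1 where "t1 = (p - n) * a * h"
  define x1 where "x1 = x + x * t1 + z * (b * h)"
  have t1: "t1 \<in> Hom p p" "t1 * t1 = 0"
    unfolding t1_def Hom_def by (simp_all add: cl' hcE rel'' algebra_simps)
  have bh: "b * h \<in> Hom p q" by (simp add: Hom_def cl' hcE rel'' mult.assoc)
  have x1: "x1 \<in> Hom p q" unfolding x1_def t1_def Hom_def by (simp add: cl' hcE rel'' algebra_simps)
  have um1: "unimodular_pair p q x1 z"
    unfolding x1_def by (intro unimodular_pair_add unimodular_pair_shear bh t1 um)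
  have x1c: "e * (x1 * c) = e"
    using hc unfolding x1_def t1_def z1_def by (simp add: rel'' algebra_simps)
  have x1E: "x1 \<in> E" using x1 by (simp add: Hom_def)
  \<comment> \<open>Through \<open>c\<close>, the columns in \<open>n\<close> supply exactly the
    difference between \<open>u\<close> and the present entry of row \<open>e\<close> in column
    \<open>e'\<close>.\<close>
  define t2 where "t2 = c * (u - e * x1 * e')"
  define x2 where "x2 = x1 + x1 * t2"
  note rel2 = rel'' HomD[OF x1] x1c x1c[unfolded mult.assoc[symmetric], THEN mult_eq_assoc, unfolded mult.assoc]
  have t2: "t2 \<in> Hom p p" "t2 * t2 = 0"
    unfolding t2_def Hom_def by (simp_all add: cl' hcE x1E rel2 algebra_simps)
  have x2: "x2 \<in> Hom p q" unfolding x2_def using x1 t2 by (intro Hom_add Hom_mult)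
  have x2E: "x2 \<in> E" using x2 by (simp add: Hom_def)
  have um2: "unimodular_pair p q x2 z"
    unfolding x2_def by (intro unimodular_pair_shear t2 um1)
  have x2v: "e * (x2 * v) = e"
    unfolding x2_def t2_def by (simp add: rel2 algebra_simps)
  have x2e: "e * (x2 * e') = u"
    unfolding x2_def t2_def by (simp add: rel2 algebra_simps)
  \<comment> \<open>Pivoting on column \<open>e'\<close>, where \<open>e * x2 * v = e\<close>. The
    square vanishes because \<open>(e' - p) * v = 0\<close>.\<close>
  define t3 where "t3 = v * e * x2 * (e' - p)"
  define x3 where "x3 = x2 + x2 * t3"
  note rel3 = rel2 HomD[OF x2] x2v x2e 
      x2v[unfolded mult.assoc[symmetric], THEN mult_eq_assoc, unfolded mult.assoc]
  have t3: "t3 \<in> Hom p p" "t3 * t3 = 0"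
    unfolding t3_def Hom_def by (simp_all add: cl' hcE x2E rel3 algebra_simps)
  have x3: "x3 \<in> Hom p q" unfolding x3_def using x2 t3 by (intro Hom_add Hom_mult)
  have um3: "unimodular_pair p q x3 z"
    unfolding x3_def by (intro unimodular_pair_shear t3 um2)
  have "e * x3 = u"
    unfolding x3_def t3_def by (simp add: rel3 algebra_simps)
  from clear_row[OF x3 this um3] have "reducible_pair p q x3 z" .
  then have "reducible_pair p q x2 z" unfolding x3_def by (rule reducible_pair_shear[OF t3])
  then have "reducible_pair p q x1 z" unfolding x2_def by (rule reducible_pair_shear[OF t2])
  then have "reducible_pair p q (x + x * t1) z" unfolding x1_def by (rule reducible_pair_add[OF bh])
  then show "reducible_pair p q x z" by (rule reducible_pair_shear[OF t1])
qed

text \<open>Extending \<open>x\<close> by the identity on \<open>r\<close> gives a unimodular pair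
  for the larger corners. In a solution there, the \<open>r\<close>-row forces
  \<open>r * y * q = 0\<close>, so \<open>h\<close> and \<open>y\<close> may be compressed to the
  corners of \<open>p\<close> and \<open>q\<close>.\<close>

lemma substitutive_cancel:
  assumes p: "p \<in> Hom p p" and q: "q \<in> Hom q q" and r: "r \<in> Hom r r"
    and orth: "p * r = 0" "r * p = 0" "q * r = 0" "r * q = 0"
    and S: "substitutive (p + r) (q + r)"
  shows "substitutive p q"
  unfolding substitutive_def
proof (intro ballI impI)
  fix x z
  assume x: "x \<in> Hom p q" and z: "z \<in> Hom q q" and um: "unimodular_pair p q x z"
  obtain a b where a: "a \<in> Hom q p" and b: "b \<in> Hom q q" and ab: "x * a + z * b = q"
    using um by (auto simp: unimodular_pair_def)
  have E: "p \<in> E" "q \<in> E" "r \<in> E" "x \<in> E" "z \<in> E" "a \<in> E" "b \<in> E"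
    using p q r x z a b by (auto simp: Hom_def)
  note rel = HomD[OF p] HomD[OF q] HomD[OF r] HomD[OF x] HomD[OF z] HomD[OF a] HomD[OF b]
    orth orth[THEN mult_eq_assoc]
  have 0: "x * r = 0" "r * x = 0" "z * r = 0" "r * z = 0"
    "a * r = 0" "r * a = 0" "b * r = 0" "r * b = 0"
    using Hom_orth[OF x] Hom_orth[OF z] Hom_orth[OF a] Hom_orth[OF b] orth by auto
  note rel = rel 0 0[THEN mult_eq_assoc]
  note cl = E mult_closed add_closed diff_closed
  have "(x + r) * (a + r) + z * b = q + r"
    using ab by (simp add: rel algebra_simps)
  then have "unimodular_pair (p + r) (q + r) (x + r) z"
    unfolding unimodular_pair_def
    by (intro bexI[of _ "a + r"] bexI[of _ b]) (simp_all add: Hom_def cl rel algebra_simps)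
  moreover have "x + r \<in> Hom (p + r) (q + r)" "z \<in> Hom (q + r) (q + r)"
    by (simp_all add: Hom_def cl rel algebra_simps)
  ultimately obtain h y where h: "h \<in> Hom (p + r) (q + r)" and y: "y \<in> Hom (q + r) (p + r)"
    and hy: "(x + r + z * h) * y = q + r"
    using S unfolding substitutive_def reducible_pair_def by blast
  have hyE: "h \<in> E" "y \<in> E" using h y by (auto simp: Hom_def)
  have py: "p * y + r * y = y" using HomD(1)[OF y] by (simp add: distrib_right)
  have "r * ((x + r + z * h) * y) * q = 0" unfolding hy by (simp add: rel algebra_simps)
  then have ry: "r * (y * q) = 0" by (simp add: rel algebra_simps)
  have "p * (y * q) = (p * y + r * y) * q"
    by (simp only: distrib_right mult.assoc ry add_0_right)
  then have py: "p * (y * q) = y * q" by (simp only: py)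
  have "(x + z * (q * h * p)) * (p * y * q) = q * ((x + r + z * h) * y) * q"
    by (simp add: rel py ry algebra_simps)
  also have "\<dots> = q" unfolding hy by (simp add: rel algebra_simps)
  finally show "reducible_pair p q x z"
    unfolding reducible_pair_def
    by (intro bexI[of _ "q * h * p"] bexI[of _ "p * y * q"])
      (simp_all add: Hom_def cl hyE rel algebra_simps)
qed

end

section \<open>Matrix units, finite powers and their summands\<close>

locale matrix_units = subring_set E for E :: "'r::ring set" +
  fixes m :: "nat \<Rightarrow> nat \<Rightarrow> 'r"
  assumes m_closed: "m i j \<in> E"
    and m_mult: "m i j * m k l = (if j = k then m i l else 0)"
begin

definition diag :: "nat \<Rightarrow> 'r" where
  "diag k = (\<Sum>i<k. m i i)"

lemma diag_Suc: "diag (Suc k) = diag k + m k k"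
  by (simp add: diag_def)

lemma diag_closed: "diag k \<in> E"
proof (induction k)
  case 0
  \<comment> \<open>Zero lies in \<open>E\<close> as the difference of a matrix unit with
    itself.\<close>
  then show ?case using diff_closed[OF m_closed m_closed, of 0 0 0 0] by (simp add: diag_def)
qed (simp add: diag_Suc add_closed m_closed)

lemma diag_mult_unit: "diag k * m i j = (if i < k then m i j else 0)"
  by (simp add: diag_def sum_distrib_right m_mult if_distrib cong: if_cong)

lemma unit_mult_diag: "m i j * diag k = (if j < k then m i j else 0)"
  by (simp add: diag_def sum_distrib_left m_mult)

lemma diag_mult: "k \<le> l \<Longrightarrow> diag k * diag l = diag k" "k \<le> l \<Longrightarrow> diag l * diag k = diag k"
  by (simp_all add: diag_def[of k] sum_distrib_left sum_distrib_right diag_mult_unit unit_mult_diag)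

text \<open>Each induction step splits off the last diagonal unit on both sides. The one of the
  first argument has index \<open>s + k\<close>, hence is orthogonal to \<open>diag s\<close>, as
  the step lemma requires.\<close>

lemma substitutive_diag:
  assumes "\<And>i. substitutive (diag s) (m i i)"
  shows "substitutive (diag (s + k)) (diag (Suc k))"
proof (induction k)
  case 0
  then show ?case using assms by (simp add: diag_def)
next
  case (Suc k)
  show ?case
  proof (rule substitutive_step[where n = "diag s" and e = "m (Suc k) (Suc k)"
        and e' = "m (s + k) (s + k)" and u = "m (Suc k) (s + k)" and v = "m (s + k) (Suc k)"])
    show "substitutive (diag (s + Suc k) - m (s + k) (s + k))
        (diag (Suc (Suc k)) - m (Suc k) (Suc k))"
      using Suc by (simp add: diag_Suc)
  qed (simp_all add: Hom_def diag_closed m_closed m_mult diag_mult diag_mult_unit unit_mult_diag assms)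
qed

text \<open>If \<open>g\<close> cuts out P inside Q^(k+1), the first idempotent cuts out Q^(s-1) +
  P; the common complement \<open>diag (Suc k) - g\<close> is cancelled. The bound
  \<open>s \<ge> 1\<close> puts \<open>diag (Suc k)\<close> below
  \<open>diag (s + k)\<close>.\<close>

lemma substitutive_summand:
  assumes S: "\<And>i. substitutive (diag s) (m i i)"
    and g: "g \<in> E" "g * g = g" "diag (Suc k) * g = g" "g * diag (Suc k) = g"
    and s: "s \<ge> 1"
  shows "substitutive (diag (s + k) - diag (Suc k) + g) g"
proof (rule substitutive_cancel[where r = "diag (Suc k) - g"])
  note rel = g diag_mult diag_closed
  have "g \<in> Hom (diag (Suc k)) (diag (Suc k))" using g by (simp add: Hom_def)
  from Hom_absorb[OF this, of "diag (s + k)"] have 1: "diag (s + k) * g = g" "g * diag (s + k) = g"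
    using s by (simp_all add: diag_mult)
  note cl = diff_closed add_closed mult_closed
  show "diag (s + k) - diag (Suc k) + g \<in> Hom (diag (s + k) - diag (Suc k) + g) (diag (s + k) - diag (Suc k) + g)"
    "g \<in> Hom g g" "diag (Suc k) - g \<in> Hom (diag (Suc k) - g) (diag (Suc k) - g)"
    "(diag (s + k) - diag (Suc k) + g) * (diag (Suc k) - g) = 0"
    "(diag (Suc k) - g) * (diag (s + k) - diag (Suc k) + g) = 0"
    "g * (diag (Suc k) - g) = 0" "(diag (Suc k) - g) * g = 0"
    using s by (simp_all add: Hom_def rel cl 1 1[unfolded add.commute[of s k]] algebra_simps)
  show "substitutive (diag (s + k) - diag (Suc k) + g + (diag (Suc k) - g)) (g + (diag (Suc k) - g))"
    using substitutive_diag[OF S] by simp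
qed

end

section \<open>Linear maps\<close>

text \<open>
  All modules involved are realised as direct summands of \<open>nat \<Rightarrow> 'q\<close>, hence as idempotents of
  the ring of its additive endomorphisms; linearity is membership in a subring.
\<close>

typedef (overloaded) 'v add_endo = "{f :: 'v::ab_group_add \<Rightarrow> 'v. \<forall>x y. f (x + y) = f x + f y}"
  morphisms app Add_endo
  by (rule exI[of _ id]) simp

setup_lifting type_definition_add_endo

instantiation add_endo :: (ab_group_add) ring
begin
lift_definition zero_add_endo :: "'a add_endo" is "\<lambda>_. 0" by simp
lift_definition plus_add_endo :: "'a add_endo \<Rightarrow> 'a add_endo \<Rightarrow> 'a add_endo" is "\<lambda>f g x. f x + g x"
  by (simp add: algebra_simps)
lift_definition minus_add_endo :: "'a add_endo \<Rightarrow> 'a add_endo \<Rightarrow> 'a add_endo" is "\<lambda>f g x. f x - g x"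
  by (simp add: algebra_simps)
lift_definition uminus_add_endo :: "'a add_endo \<Rightarrow> 'a add_endo" is "\<lambda>f x. - f x" by simp
lift_definition times_add_endo :: "'a add_endo \<Rightarrow> 'a add_endo \<Rightarrow> 'a add_endo" is "\<lambda>f g x. f (g x)"
  by simp
instance by standard (transfer; auto simp: fun_eq_iff algebra_simps)+
end

lemma app_Add_endo: "(\<And>x y. f (x + y) = f x + f y) \<Longrightarrow> app (Add_endo f) = f"
  by (simp add: Add_endo_inverse)

lemma add_endo_eqI: "(\<And>x. app r x = app s x) \<Longrightarrow> r = s"
  using app_inject by blast

lemmas app_simps = zero_add_endo.rep_eq plus_add_endo.rep_eq minus_add_endo.rep_eq
  times_add_endo.rep_eq

lemma sum_fun_apply: "(\<Sum>i\<in>A. f i) x = (\<Sum>i\<in>A. f i x)"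
  by (induction A rule: infinite_finite_induct) simp_all

section \<open>Right linear maps between modules\<close>

definition right_linear :: "('x::ab_group_add \<Rightarrow> 'a::ring_1 \<Rightarrow> 'x) \<Rightarrow>
    ('y::ab_group_add \<Rightarrow> 'a \<Rightarrow> 'y) \<Rightarrow> ('x \<Rightarrow> 'y) \<Rightarrow> bool" where
  "right_linear sx sy f \<longleftrightarrow> (\<forall>x y. f (x + y) = f x + f y) \<and> (\<forall>x a. f (sx x a) = sy (f x) a)"

lemma is_endo_iff: "is_endo sm = right_linear sm sm"
  by (auto simp: is_endo_def right_linear_def fun_eq_iff)

lemma hom_to_A_iff: "hom_to_A sm = right_linear sm (*)"
  by (auto simp: hom_to_A_def right_linear_def fun_eq_iff)

lemma right_linear_add: "right_linear sx sy f \<Longrightarrow> f (x + y) = f x + f y"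
  by (simp add: right_linear_def)

lemma right_linear_0: "right_linear sx sy f \<Longrightarrow> f 0 = 0"
  using right_linear_add[of sx sy f 0 0] by simp

lemma right_linear_diff: "right_linear sx sy f \<Longrightarrow> f (x - y) = f x - f y"
  using right_linear_add[of sx sy f "x - y" y] by simp

lemma right_linear_sum: "right_linear sx sy f \<Longrightarrow> f (sum g A) = (\<Sum>i\<in>A. f (g i))"
  by (induction A rule: infinite_finite_induct) (simp_all add: right_linear_add right_linear_0)

lemma right_linear_compose:
  "right_linear sy sz f \<Longrightarrow> right_linear sx sy g \<Longrightarrow> right_linear sx sz (\<lambda>x. f (g x))"
  by (simp add: right_linear_def)

lemma right_module_0: "right_module sm \<Longrightarrow> sm 0 a = 0"
  unfolding right_module_def by (metis add_cancel_right_right)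

lemma right_linear_zero: "right_module sy \<Longrightarrow> right_linear sx sy (\<lambda>_. 0)"
  by (simp add: right_linear_def right_module_0)

lemma right_linear_plus:
  "right_module sy \<Longrightarrow> right_linear sx sy f \<Longrightarrow> right_linear sx sy g \<Longrightarrow> right_linear sx sy (\<lambda>x. f x + g x)"
  by (simp add: right_linear_def right_module_def algebra_simps)

lemma right_linear_uminus:
  assumes sy: "right_module sy" and f: "right_linear sx sy f"
  shows "right_linear sx sy (\<lambda>x. - f x)"
proof -
  have "sy (- y) a = - sy y a" for y a
  proof -
    have "sy (- y + y) a = sy (- y) a + sy y a" using sy unfolding right_module_def by blast
    then show ?thesis by (simp add: right_module_0[OF sy] eq_neg_iff_add_eq_0)
  qed
  with f show ?thesis by (simp add: right_linear_def)
qed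

lemma right_linear_minus:
  "right_module sy \<Longrightarrow> right_linear sx sy f \<Longrightarrow> right_linear sx sy g \<Longrightarrow> right_linear sx sy (\<lambda>x. f x - g x)"
  using right_linear_plus[OF _ _ right_linear_uminus, of sy sx f g] by simp

lemma right_linear_sum_fun:
  "right_module sy \<Longrightarrow> (\<And>i. i \<in> A \<Longrightarrow> right_linear sx sy (f i)) \<Longrightarrow>
   right_linear sx sy (\<lambda>x. \<Sum>i\<in>A. f i x)"
  by (induction A rule: infinite_finite_induct) (simp_all add: right_linear_plus right_linear_zero)

section \<open>Sequence modules and their matrix units\<close>

definition pointwise :: "('q \<Rightarrow> 'a \<Rightarrow> 'q) \<Rightarrow> (nat \<Rightarrow> 'q) \<Rightarrow> 'a \<Rightarrow> nat \<Rightarrow> 'q" where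
  "pointwise sm f a = (\<lambda>i. sm (f i) a)"

definition single :: "nat \<Rightarrow> 'q::zero \<Rightarrow> nat \<Rightarrow> 'q" where
  "single i v = (\<lambda>j. if j = i then v else 0)"

definition matrix_unit :: "nat \<Rightarrow> nat \<Rightarrow> (nat \<Rightarrow> 'q::ab_group_add) add_endo" where
  "matrix_unit i j = Add_endo (\<lambda>f. single i (f j))"

lemma app_matrix_unit: "app (matrix_unit i j) f = single i (f j)"
  unfolding matrix_unit_def by (subst app_Add_endo) (auto simp: single_def)

definition linear_endos :: "('q::ab_group_add \<Rightarrow> 'a::ring_1 \<Rightarrow> 'q) \<Rightarrow> (nat \<Rightarrow> 'q) add_endo set" where
  "linear_endos sm = {r. right_linear (pointwise sm) (pointwise sm) (app r)}"

text \<open>This is S(Q^n, Q) in components, with the last entry of a unimodular row and its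
  coefficient merged into the one endomorphism \<open>z\<close>.\<close>

definition row_cond :: "('q::ab_group_add \<Rightarrow> 'a::ring_1 \<Rightarrow> 'q) \<Rightarrow> nat \<Rightarrow> bool" where
  "row_cond sm n \<longleftrightarrow> (\<forall>b a z. (\<forall>i<n. is_endo sm (b i)) \<and> (\<forall>i<n. is_endo sm (a i)) \<and> is_endo sm z \<and>
      (\<forall>x. (\<Sum>i<n. b i (a i x)) + z x = x) \<longrightarrow>
      (\<exists>h y. (\<forall>i<n. is_endo sm (h i)) \<and> (\<forall>i<n. is_endo sm (y i)) \<and>
        (\<forall>x. (\<Sum>i<n. b i (y i x) + z (h i (y i x))) = x)))"

lemma row_condE:
  assumes "row_cond sm n" "\<And>i. i < n \<Longrightarrow> is_endo sm (b i)" "\<And>i. i < n \<Longrightarrow> is_endo sm (a i)" "is_endo sm z"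
    "\<And>x. (\<Sum>i<n. b i (a i x)) + z x = x"
  obtains h y where "\<forall>i<n. is_endo sm (h i)" "\<forall>i<n. is_endo sm (y i)"
    "\<And>x. (\<Sum>i<n. b i (y i x) + z (h i (y i x))) = x"
proof -
  have "\<exists>h y. (\<forall>i<n. is_endo sm (h i)) \<and> (\<forall>i<n. is_endo sm (y i)) \<and>
      (\<forall>x. (\<Sum>i<n. b i (y i x) + z (h i (y i x))) = x)"
    using assms(1) unfolding row_cond_def
    by (elim allE[of _ b] allE[of _ a] allE[of _ z] impE) (use assms in auto)
  then show thesis using that by blast
qed

locale right_mod =
  fixes sm :: "'q::ab_group_add \<Rightarrow> 'a::ring_1 \<Rightarrow> 'q"
  assumes right_module: "right_module sm"
begin

lemma right_module_pointwise: "right_module (pointwise sm)"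
  using right_module by (auto simp: right_module_def pointwise_def fun_eq_iff)

lemma right_linear_single: "right_linear sm (pointwise sm) (single i)"
  by (auto simp: right_linear_def single_def pointwise_def right_module_0[OF right_module])

lemma right_linear_coord: "right_linear (pointwise sm) sm (\<lambda>f. f i)"
  by (simp add: right_linear_def pointwise_def)

lemma right_linear_tuple:
  assumes "\<And>i. right_linear sx sm (\<lambda>x. f x i)"
  shows "right_linear sx (pointwise sm) f"
  using assms by (auto simp: right_linear_def pointwise_def fun_eq_iff)

lemma linear_endosD: "r \<in> linear_endos sm \<Longrightarrow> right_linear (pointwise sm) (pointwise sm) (app r)"
  by (simp add: linear_endos_def)

lemma
  assumes "right_linear (pointwise sm) (pointwise sm) f"
  shows app_Add_endo_linear: "app (Add_endo f) = f"
    and Add_endo_linear: "Add_endo f \<in> linear_endos sm"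
proof -
  show *: "app (Add_endo f) = f"
    using assms by (intro app_Add_endo) (simp add: right_linear_def)
  show "Add_endo f \<in> linear_endos sm"
    using assms by (simp add: linear_endos_def *)
qed

sublocale matrix_units "linear_endos sm" matrix_unit
proof
  fix r s :: "(nat \<Rightarrow> 'q) add_endo" assume rs: "r \<in> linear_endos sm" "s \<in> linear_endos sm"
  show "r * s \<in> linear_endos sm"
    using rs by (simp add: linear_endos_def app_simps right_linear_compose)
  show "r + s \<in> linear_endos sm"
    using rs by (auto simp: linear_endos_def app_simps intro: right_linear_plus right_module_pointwise)
  show "r - s \<in> linear_endos sm"
    using rs by (auto simp: linear_endos_def app_simps intro: right_linear_minus right_module_pointwise)
next
  fix i j k l :: nat
  show "matrix_unit i j \<in> linear_endos sm"
    unfolding matrix_unit_def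
    by (intro Add_endo_linear right_linear_compose[OF right_linear_single right_linear_coord])
  show "(matrix_unit i j :: (nat \<Rightarrow> 'q) add_endo) * matrix_unit k l = (if j = k then matrix_unit i l else 0)"
    by (rule add_endo_eqI) (auto simp: app_simps app_matrix_unit single_def)
qed

lemma app_diag: "app (diag k) f = (\<lambda>j. if j < k then f j else 0)"
proof (induction k)
  case 0
  then show ?case by (simp add: diag_def app_simps zero_fun_def)
next
  case (Suc k)
  then show ?case by (auto simp: diag_Suc app_simps app_matrix_unit single_def fun_eq_iff)
qed

lemma app_diag_sum: "app (diag k) f = (\<Sum>i<k. single i (f i))"
  by (auto simp: fun_eq_iff sum_fun_apply single_def app_diag)

text \<open>An element of the corner from \<open>diag s\<close> to a diagonal unit amounts to a row
  of \<open>s\<close> endomorphisms, so \<open>row_cond\<close> can be applied to its entries and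
  the answer reassembled.\<close>

lemma substitutive_unit:
  assumes row: "row_cond sm s"
  shows "substitutive (diag s) (matrix_unit k k)"
  unfolding substitutive_def
proof (intro ballI impI)
  fix x z
  assume x: "x \<in> Hom (diag s) (matrix_unit k k)" and z: "z \<in> Hom (matrix_unit k k) (matrix_unit k k)"
    and "unimodular_pair (diag s) (matrix_unit k k) x z"
  then obtain a b where a: "a \<in> Hom (matrix_unit k k) (diag s)" and b: "b \<in> Hom (matrix_unit k k) (matrix_unit k k)"
    and ab: "x * a + z * b = matrix_unit k k"
    by (auto simp: unimodular_pair_def)
  have lin: "right_linear (pointwise sm) (pointwise sm) (app x)" "right_linear (pointwise sm) (pointwise sm) (app z)"
    "right_linear (pointwise sm) (pointwise sm) (app a)" "right_linear (pointwise sm) (pointwise sm) (app b)"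
    using x z a b by (auto simp: Hom_def intro: linear_endosD)
  have xk: "app x f = single k (app x f k)" for f
    using arg_cong[OF HomD(1)[OF x], of "\<lambda>r. app r f"] by (simp add: app_matrix_unit app_simps)
  have zk: "app z f = single k (app z f k)" for f
    using arg_cong[OF HomD(1)[OF z], of "\<lambda>r. app r f"] by (simp add: app_matrix_unit app_simps)
  have expand: "app x f = (\<Sum>i<s. app x (single i (f i)))" for f
    using arg_cong[OF HomD(2)[OF x], of "\<lambda>r. app r f"]
    by (simp add: app_simps app_diag_sum right_linear_sum[OF lin(1)])
  note homs = right_linear_compose[OF lin(1)] right_linear_compose[OF lin(2)] right_linear_compose[OF lin(3)]
    right_linear_compose[OF lin(4)] right_linear_single right_linear_compose[OF right_linear_coord]
  define X where "X i v = app x (single i v) k" for i v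
  define A where "A i v = app a (single k v) i" for i v
  \<comment> \<open>The coefficient \<open>b\<close> is merged into \<open>Z\<close>, which is why
    the perturbation below is \<open>b * H\<close>.\<close>
  define Z where "Z v = app z (app b (single k v)) k" for v
  have endo: "is_endo sm (X i)" "is_endo sm (A i)" "is_endo sm Z" for i
    unfolding X_def[abs_def] A_def[abs_def] Z_def[abs_def] is_endo_iff by (rule homs)+
  have "(\<Sum>i<s. X i (A i v)) + Z v = v" for v
  proof -
    have "(\<Sum>i<s. X i (A i v)) = app x (app a (single k v)) k"
      unfolding X_def A_def by (subst (2) expand) (simp add: sum_fun_apply)
    moreover have "app (x * a + z * b) (single k v) k = v"
      unfolding ab by (simp add: app_matrix_unit single_def)
    ultimately show ?thesis by (simp add: app_simps Z_def)
  qed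
  then obtain h y where h: "\<forall>i<s. is_endo sm (h i)" and y: "\<forall>i<s. is_endo sm (y i)"
    and hy: "\<And>v. (\<Sum>i<s. X i (y i v) + Z (h i (y i v))) = v"
    using row_condE[OF row, of X A Z] endo by blast
  define H where "H = Add_endo (\<lambda>f. single k (\<Sum>i<s. h i (f i)))"
  define Y where "Y = Add_endo (\<lambda>f i. if i < s then y i (f k) else 0)"
  have H_lin: "right_linear (pointwise sm) (pointwise sm) (\<lambda>f. single k (\<Sum>i<s. h i (f i)))"
  proof (intro right_linear_compose[OF right_linear_single] right_linear_sum_fun right_module)
    fix i assume "i \<in> {..<s}"
    with h show "right_linear (pointwise sm) sm (\<lambda>f. h i (f i))"
      using right_linear_compose[OF _ right_linear_coord, of sm "h i" i] by (simp add: is_endo_iff)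
  qed
  have "right_linear (pointwise sm) sm (\<lambda>f. if i < s then y i (f k) else 0)" for i
    using y right_linear_compose[OF _ right_linear_coord, of sm "y i" k]
    by (cases "i < s") (auto simp: is_endo_iff right_linear_zero right_module)
  then have Y_lin: "right_linear (pointwise sm) (pointwise sm) (\<lambda>f i. if i < s then y i (f k) else 0)"
    by (intro right_linear_tuple)
  have appH: "app H f = single k (\<Sum>i<s. h i (f i))" for f
    unfolding H_def by (simp add: app_Add_endo_linear[OF H_lin])
  have appY: "app Y f = (\<lambda>i. if i < s then y i (f k) else 0)" for f
    unfolding Y_def by (simp add: app_Add_endo_linear[OF Y_lin])
  have H: "H \<in> Hom (diag s) (matrix_unit k k)"
    unfolding Hom_def using Add_endo_linear[OF H_lin, folded H_def]
    by (auto simp: app_simps appH app_matrix_unit app_diag single_def intro!: add_endo_eqI)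
  have Y: "Y \<in> Hom (matrix_unit k k) (diag s)"
    unfolding Hom_def using Add_endo_linear[OF Y_lin, folded Y_def]
    by (auto simp: app_simps appY app_matrix_unit app_diag single_def intro!: add_endo_eqI)
  have "(x + z * (b * H)) * Y = matrix_unit k k"
  proof (rule add_endo_eqI)
    fix f
    have "app x (app Y f) = single k (app x (app Y f) k)" by (rule xk)
    also have "app x (app Y f) k = (\<Sum>i<s. X i (y i (f k)))"
      unfolding X_def by (subst expand) (simp add: sum_fun_apply appY)
    finally have 1: "app x (app Y f) = single k (\<Sum>i<s. X i (y i (f k)))" .
    have "app z (app b (app H (app Y f))) = single k (Z (\<Sum>i<s. h i (y i (f k))))"
      unfolding Z_def by (subst zk) (simp add: appH appY)
    also have "\<dots> = single k (\<Sum>i<s. Z (h i (y i (f k))))"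
      using endo(3) by (simp add: is_endo_iff right_linear_sum)
    finally have "app ((x + z * (b * H)) * Y) f
        = single k (\<Sum>i<s. X i (y i (f k)) + Z (h i (y i (f k))))"
      using 1 by (simp add: app_simps sum.distrib right_linear_add[OF right_linear_single])
    then show "app ((x + z * (b * H)) * Y) f = app (matrix_unit k k) f"
      by (simp add: hy app_matrix_unit)
  qed
  then show "reducible_pair (diag s) (matrix_unit k k) x z"
    unfolding reducible_pair_def using H Y b Hom_mult by blast
qed

end

section \<open>Transfer of rows between modules\<close>

context right_mod
begin

text \<open>This is S(P + Q^r, P) in components, for P a direct summand of Q^m through
  \<open>u\<close> and \<open>v\<close>. Coordinates below \<open>m\<close> carry the copy of P in
  Q^m, and the next \<open>r\<close> coordinates carry Q^r.\<close>

lemma summand_rows: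
  fixes sp :: "'p::ab_group_add \<Rightarrow> 'a \<Rightarrow> 'p" and m r :: nat
  assumes sp: "right_module sp"
    and u: "\<And>i. i < m \<Longrightarrow> right_linear sp sm (u i)"
    and v: "\<And>i. i < m \<Longrightarrow> right_linear sm sp (v i)"
    and vu: "\<And>x. (\<Sum>i<m. v i (u i x)) = x"
    and m: "m > 0"
    and row: "row_cond sm (Suc r)"
    and b0: "right_linear sp sp b0" and a0: "right_linear sp sp a0" and z: "right_linear sp sp z"
    and b: "\<And>j. j < r \<Longrightarrow> right_linear sm sp (b j)"
    and a: "\<And>j. j < r \<Longrightarrow> right_linear sp sm (a j)"
    and ba: "\<And>x. b0 (a0 x) + (\<Sum>j<r. b j (a j x)) + z x = x"
  obtains h0 h y0 y where "right_linear sp sp h0" "right_linear sp sp y0"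
    "\<And>j. j < r \<Longrightarrow> right_linear sm sp (h j)" "\<And>j. j < r \<Longrightarrow> right_linear sp sm (y j)"
    "\<And>x. b0 (y0 x) + (\<Sum>j<r. b j (y j x)) + z (h0 (y0 x) + (\<Sum>j<r. h j (y j x))) = x"
proof -
  define I where "I x = (\<lambda>i. if i < m then u i x else 0)" for x
  define J where "J f = (\<Sum>i<m. v i (f i))" for f
  define T where "T f = b0 (J f) + (\<Sum>j<r. b j (f (m + j)))" for f
  define A where "A x = (\<lambda>i. if i < m then u i (a0 x) else if i < m + r then a (i - m) x else 0)" for x
  have "right_linear sp sm (\<lambda>x. I x i)" for i
    unfolding I_def by (cases "i < m") (simp_all add: u right_linear_zero right_module)
  then have I_lin: "right_linear sp (pointwise sm) I"
    by (rule right_linear_tuple)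
  have "right_linear (pointwise sm) sp (\<lambda>f. v i (f i))" if "i < m" for i
    using v[OF that] right_linear_coord by (rule right_linear_compose)
  then have J_lin: "right_linear (pointwise sm) sp J"
    unfolding J_def[abs_def] by (intro right_linear_sum_fun sp) simp
  have "right_linear (pointwise sm) sp (\<lambda>f. b j (f (m + j)))" if "j < r" for j
    using b[OF that] right_linear_coord by (rule right_linear_compose)
  then have T_lin: "right_linear (pointwise sm) sp T"
    unfolding T_def[abs_def]
    by (intro right_linear_plus right_linear_sum_fun right_linear_compose[OF b0 J_lin] sp) simp
  have "right_linear sp sm (\<lambda>x. A x i)" for i
  proof -
    consider "i < m" | "\<not> i < m" "i < m + r" | "\<not> i < m + r" by linarith
    then show ?thesis
    proof cases
      case 1 then show ?thesis unfolding A_def by (simp add: right_linear_compose[OF u a0])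
    next
      case 2 then show ?thesis unfolding A_def using a[of "i - m"] by simp
    next
      case 3 then show ?thesis unfolding A_def by (simp add: right_linear_zero right_module)
    qed
  qed
  then have A_lin: "right_linear sp (pointwise sm) A"
    by (rule right_linear_tuple)
  have JI: "J (I x) = x" for x
    unfolding J_def I_def using vu by simp
  have JA: "J (A x) = a0 x" for x
    unfolding J_def A_def using vu by simp
  have TA: "T (A x) = b0 (a0 x) + (\<Sum>j<r. b j (a j x))" for x
    unfolding T_def JA by (simp add: A_def)

  define g where "g = Add_endo (\<lambda>f. I (J f))"
  have g_lin: "right_linear (pointwise sm) (pointwise sm) (\<lambda>f. I (J f))"
    by (rule right_linear_compose[OF I_lin J_lin])
  have appg: "app g f = I (J f)" for f
    unfolding g_def by (simp add: app_Add_endo_linear[OF g_lin])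
  have gE: "g \<in> linear_endos sm" unfolding g_def by (rule Add_endo_linear[OF g_lin])
  obtain k where k: "m = Suc k" using m by (cases m) auto
  \<comment> \<open>As \<open>m = Suc k\<close>, this is the idempotent of P + Q^r: \<open>g\<close>
    on the first \<open>m\<close> coordinates, the identity on the next \<open>r\<close>.\<close>
  define D where "D = diag (Suc r + k) - diag (Suc k) + g"
  have D_eq: "Suc r + k = m + r" by (simp add: k)
  have appD: "app D f i = (if i < m then 0 else if i < m + r then f i else 0) + I (J f) i" for f i
    unfolding D_def D_eq k[symmetric] by (auto simp: app_simps app_diag appg)
  have JD: "J (app D f) = J f" for f
  proof -
    have "J (app D f) = J (I (J f))" unfolding J_def[of "app D f"] J_def[of "I (J f)"]
      by (rule sum.cong) (simp_all add: appD)
    then show ?thesis by (simp add: JI)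
  qed
  have TD: "T (app D f) = T f" for f
    unfolding T_def JD by (simp add: appD I_def)
  have DA: "app D (A x) = A x" for x
    unfolding appD JA fun_eq_iff by (simp add: I_def A_def)
  have S: "substitutive D g"
    unfolding D_def
  proof (rule substitutive_summand)
    show "substitutive (diag (Suc r)) (matrix_unit i i)" for i
      by (rule substitutive_unit[OF row])
    show "g \<in> linear_endos sm" by (rule gE)
    show "g * g = g" by (rule add_endo_eqI) (simp add: app_simps appg JI)
    show "diag (Suc k) * g = g"
      by (rule add_endo_eqI) (auto simp: app_simps appg app_diag I_def k)
    show "g * diag (Suc k) = g"
      by (rule add_endo_eqI) (simp add: app_simps appg app_diag J_def k)
  qed simp

  \<comment> \<open>The row, its coefficients and \<open>z\<close> are transported to the sequence
    module along \<open>I\<close> and \<open>J\<close>.\<close>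
  define X where "X = Add_endo (\<lambda>f. I (T f))"
  define AA where "AA = Add_endo (\<lambda>f. A (J f))"
  define Z where "Z = Add_endo (\<lambda>f. I (z (J f)))"
  note X_lin = right_linear_compose[OF I_lin T_lin]
  note AA_lin = right_linear_compose[OF A_lin J_lin]
  note Z_lin = right_linear_compose[OF I_lin right_linear_compose[OF z J_lin]]
  have appX: "app X f = I (T f)" for f
    unfolding X_def by (simp add: app_Add_endo_linear[OF X_lin])
  have appAA: "app AA f = A (J f)" for f
    unfolding AA_def by (simp add: app_Add_endo_linear[OF AA_lin])
  have appZ: "app Z f = I (z (J f))" for f
    unfolding Z_def by (simp add: app_Add_endo_linear[OF Z_lin])
  have X: "X \<in> Hom D g"
    unfolding Hom_def using Add_endo_linear[OF X_lin, folded X_def]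
    by (auto simp: app_simps appX appg JI TD intro!: add_endo_eqI)
  have AA: "AA \<in> Hom g D"
    unfolding Hom_def using Add_endo_linear[OF AA_lin, folded AA_def]
    by (auto simp: app_simps appAA appg JI DA intro!: add_endo_eqI)
  have Z: "Z \<in> Hom g g"
    unfolding Hom_def using Add_endo_linear[OF Z_lin, folded Z_def]
    by (auto simp: app_simps appZ appg JI intro!: add_endo_eqI)
  have g: "g \<in> Hom g g"
    unfolding Hom_def using gE
    by (auto simp: app_simps appg JI intro!: add_endo_eqI)
  have "X * AA + Z * g = g"
  proof (rule add_endo_eqI)
    fix f
    have "app (X * AA + Z * g) f = I (T (A (J f)) + z (J f))"
      by (simp add: app_simps appX appAA appZ appg JI right_linear_add[OF I_lin])
    then show "app (X * AA + Z * g) f = app g f" by (simp add: TA ba appg)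
  qed
  then have "unimodular_pair D g X Z" unfolding unimodular_pair_def using AA g by blast
  then obtain H Y where H: "H \<in> Hom D g" and Y: "Y \<in> Hom g D" and HY: "(X + Z * H) * Y = g"
    using S X Z unfolding substitutive_def reducible_pair_def by blast
  have H_lin: "right_linear (pointwise sm) (pointwise sm) (app H)"
    and Y_lin: "right_linear (pointwise sm) (pointwise sm) (app Y)"
    using H Y by (auto simp: Hom_def intro: linear_endosD)
  define P where "P f = J (app H f)" for f
  define Q where "Q x = app Y (I x)" for x
  have P_lin: "right_linear (pointwise sm) sp P"
    unfolding P_def[abs_def] by (rule right_linear_compose[OF J_lin H_lin])
  have Q_lin: "right_linear sp (pointwise sm) Q"
    unfolding Q_def[abs_def] by (rule right_linear_compose[OF Y_lin I_lin])
  have TQ: "T (Q x) + z (P (Q x)) = x" for x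
  proof -
    have "J (app ((X + Z * H) * Y) (I x)) = T (Q x) + z (P (Q x))"
      by (simp add: app_simps appX appZ JI right_linear_add[OF J_lin] P_def Q_def)
    then show ?thesis by (simp add: HY appg JI)
  qed
  have "app Y f = app D (app Y f)" for f
    using arg_cong[OF HomD(1)[OF Y], of "\<lambda>r. app r f"] by (simp add: app_simps)
  then have DQ: "Q x = app D (Q x)" for x unfolding Q_def .
  \<comment> \<open>A vector fixed by \<open>D\<close> is determined by its component in P and its
    coordinates \<open>m + j\<close>; this is what lets \<open>P\<close> be evaluated entry by
    entry.\<close>
  have Q_split: "Q x = I (J (Q x)) + (\<Sum>j<r. single (m + j) (Q x (m + j)))" for x
  proof (rule ext)
    fix i
    have eq: "(\<Sum>j<r. single (m + j) (Q x (m + j)) i) = (if i < m then 0 else if i < m + r then Q x i else 0)"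
    proof (cases "m \<le> i \<and> i < m + r")
      case True
      then have "(\<Sum>j<r. single (m + j) (Q x (m + j)) i) = (\<Sum>j<r. if j = i - m then Q x i else 0)"
        by (intro sum.cong) (auto simp: single_def)
      then show ?thesis using True by auto
    next
      case False
      then show ?thesis by (auto simp: single_def intro!: sum.neutral)
    qed
    show "Q x i = (I (J (Q x)) + (\<Sum>j<r. single (m + j) (Q x (m + j)))) i"
      using fun_cong[OF DQ, of x i] 
      unfolding appD plus_fun_apply sum_fun_apply eq by (simp only: add.commute)
  qed
  show thesis
  proof (rule that)
    show "right_linear sp sp (\<lambda>x. P (I x))" by (rule right_linear_compose[OF P_lin I_lin])
    show "right_linear sp sp (\<lambda>x. J (Q x))" by (rule right_linear_compose[OF J_lin Q_lin])
    show "right_linear sm sp (\<lambda>x. P (single (m + j) x))" for j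
      by (rule right_linear_compose[OF P_lin right_linear_single])
    show "right_linear sp sm (\<lambda>x. Q x (m + j))" for j
      by (rule right_linear_compose[OF right_linear_coord Q_lin])
    fix x
    have "P (Q x) = P (I (J (Q x))) + (\<Sum>j<r. P (single (m + j) (Q x (m + j))))"
      by (subst Q_split) (simp add: right_linear_add[OF P_lin] right_linear_sum[OF P_lin])
    then show "b0 (J (Q x)) + (\<Sum>j<r. b j (Q x (m + j))) +
        z (P (I (J (Q x))) + (\<Sum>j<r. P (single (m + j) (Q x (m + j))))) = x"
      using TQ[of x] by (simp add: T_def)
  qed
qed

end

section \<open>Rows grouped into blocks and transferred between modules\<close>

lemma sum_blocks: "(\<Sum>i<r * t. f i) = (\<Sum>j<r. \<Sum>l<t. f (j * t + l))" for f :: "nat \<Rightarrow> 'b::comm_monoid_add"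
proof (induction r)
  case (Suc r)
  have "(\<Sum>i<Suc r * t. f i) = (\<Sum>i<r * t. f i) + (\<Sum>i\<in>{r * t..<r * t + t}. f i)"
    using sum.atLeastLessThan_concat[of 0 "r * t" "r * t + t" f]
    by (simp add: lessThan_atLeast0 add.commute)
  also have "(\<Sum>i\<in>{r * t..<r * t + t}. f i) = (\<Sum>l<t. f (r * t + l))"
    using sum.shift_bounds_nat_ivl[of f 0 "r * t" t] by (simp add: lessThan_atLeast0 add.commute)
  finally show ?case by (simp add: Suc)
qed simp

text \<open>Here P is a summand of Q^m through \<open>u\<close>, \<open>v\<close>, and Q is a
  summand of P^t through \<open>w\<close>, \<open>c\<close>. A row of length
  \<open>r * t + 1\<close> is one entry followed by \<open>r\<close> blocks of length
  \<open>t\<close>; restricting each block to its copy of Q leaves a row on P + Q^r, to which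
  \<open>summand_rows\<close> applies.\<close>

theorem row_cond_transfer:
  fixes sp :: "'p::ab_group_add \<Rightarrow> 'a::ring_1 \<Rightarrow> 'p" and sq :: "'q::ab_group_add \<Rightarrow> 'a \<Rightarrow> 'q"
    and m r t :: nat
  assumes sp: "right_module sp" and sq: "right_module sq"
    and u: "\<And>i. i < m \<Longrightarrow> right_linear sp sq (u i)"
    and v: "\<And>i. i < m \<Longrightarrow> right_linear sq sp (v i)"
    and vu: "\<And>x. (\<Sum>i<m. v i (u i x)) = x" and m: "m > 0"
    and w: "\<And>i. i < t \<Longrightarrow> right_linear sq sp (w i)"
    and c: "\<And>i. i < t \<Longrightarrow> right_linear sp sq (c i)"
    and cw: "\<And>x. (\<Sum>i<t. c i (w i x)) = x"
    and row: "row_cond sq (Suc r)"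
  shows "row_cond sp (Suc (r * t))"
  unfolding row_cond_def is_endo_iff
proof (intro allI impI; elim conjE)
  fix b a :: "nat \<Rightarrow> 'p \<Rightarrow> 'p" and z :: "'p \<Rightarrow> 'p"
  assume b: "\<forall>i<Suc (r * t). right_linear sp sp (b i)"
    and a: "\<forall>i<Suc (r * t). right_linear sp sp (a i)"
    and z: "right_linear sp sp z"
    and ba: "\<forall>x. (\<Sum>i<Suc (r * t). b i (a i x)) + z x = x"
  interpret Q: right_mod sq by unfold_locales (rule sq)
  have split: "(\<Sum>i<Suc (r * t). f i) = f 0 + (\<Sum>j<r. \<Sum>l<t. f (Suc (j * t + l)))" for f :: "nat \<Rightarrow> 'p"
    by (simp add: sum.lessThan_Suc_shift sum_blocks del: sum.lessThan_Suc)
  define B where "B j l = b (Suc (j * t + l))" for j l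
  define A where "A j l = a (Suc (j * t + l))" for j l
  have idx: "Suc (j * t + l) < Suc (r * t)" if "j < r" "l < t" for j l
  proof -
    have "j * t + l < Suc j * t" using that by simp
    also have "\<dots> \<le> r * t" using that by (intro mult_le_mono1) simp
    finally show ?thesis by simp
  qed
  have B: "right_linear sp sp (B j l)" and A: "right_linear sp sp (A j l)" if "j < r" "l < t" for j l
    using a b idx[OF that] by (auto simp: A_def B_def)
  have b0: "right_linear sp sp (b 0)" and a0: "right_linear sp sp (a 0)" using a b by auto
  txt \<open>
    Each block of \<open>t\<close> copies of \<open>P\<close> contains a copy of \<open>Q\<close>; the component \<open>\<delta>\<close> of the solution in the
    complement of that copy is moved into \<open>Z\<close>.
  \<close>
  define G where "G j x = (\<Sum>l<t. B j l (w l x))" for j x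
  define K where "K j x = (\<Sum>l<t. c l (A j l x))" for j x
  define \<delta> where "\<delta> j l x = A j l x - w l (K j x)" for j l x
  define Z where "Z x = (\<Sum>j<r. \<Sum>l<t. B j l (\<delta> j l x)) + z x" for x
  have G: "right_linear sq sp (G j)" if "j < r" for j
    unfolding G_def[abs_def] using that by (intro right_linear_sum_fun sp right_linear_compose[OF B w]) auto
  have K: "right_linear sp sq (K j)" if "j < r" for j
    unfolding K_def[abs_def] using that by (intro right_linear_sum_fun sq right_linear_compose[OF c A]) auto
  have \<delta>: "right_linear sp sp (\<delta> j l)" if "j < r" "l < t" for j l
    unfolding \<delta>_def[abs_def] using that by (intro right_linear_minus sp right_linear_compose[OF w K] A)
  have Z: "right_linear sp sp Z"
    unfolding Z_def[abs_def]
    by (intro right_linear_plus right_linear_sum_fun sp right_linear_compose[OF B \<delta>] z) auto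
  have c\<delta>: "(\<Sum>l<t. c l (\<delta> j l x)) = 0" if "j < r" for j x
  proof -
    have "(\<Sum>l<t. c l (\<delta> j l x)) = (\<Sum>l<t. c l (A j l x) - c l (w l (K j x)))"
      by (rule sum.cong) (simp_all add: \<delta>_def right_linear_diff[OF c])
    then show ?thesis by (simp add: sum_subtractf cw K_def)
  qed
  have GK: "G j (K j x) + (\<Sum>l<t. B j l (\<delta> j l x)) = (\<Sum>l<t. B j l (A j l x))" if "j < r" for j x
  proof -
    have "(\<Sum>l<t. B j l (\<delta> j l x)) = (\<Sum>l<t. B j l (A j l x) - B j l (w l (K j x)))"
      using that by (intro sum.cong) (simp_all add: \<delta>_def right_linear_diff[OF B])
    then show ?thesis by (simp add: sum_subtractf G_def)
  qed
  have GKZ: "b 0 (a 0 x) + (\<Sum>j<r. G j (K j x)) + Z x = x" for x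
  proof -
    have "(\<Sum>j<r. G j (K j x)) + (\<Sum>j<r. \<Sum>l<t. B j l (\<delta> j l x)) = (\<Sum>j<r. \<Sum>l<t. B j l (A j l x))"
      unfolding sum.distrib[symmetric] by (rule sum.cong) (simp_all add: GK)
    moreover have "b 0 (a 0 x) + (\<Sum>j<r. \<Sum>l<t. B j l (A j l x)) + z x = x"
      using ba[rule_format, of x] unfolding split A_def B_def .
    ultimately show ?thesis by (simp add: Z_def algebra_simps)
  qed
  obtain h0 h y0 y where h0: "right_linear sp sp h0" and y0: "right_linear sp sp y0"
    and h: "\<And>j. j < r \<Longrightarrow> right_linear sq sp (h j)" and y: "\<And>j. j < r \<Longrightarrow> right_linear sp sq (y j)"
    and hy: "\<And>x. b 0 (y0 x) + (\<Sum>j<r. G j (y j x)) + Z (h0 (y0 x) + (\<Sum>j<r. h j (y j x))) = x"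
    by (rule Q.summand_rows[OF sp u v vu m row b0 a0 Z G K GKZ]) (assumption | rule that)+
  define \<eta> where "\<eta> x = h0 (y0 x) + (\<Sum>j<r. h j (y j x))" for x
  have \<eta>: "right_linear sp sp \<eta>"
    unfolding \<eta>_def[abs_def]
    by (intro right_linear_plus right_linear_sum_fun sp right_linear_compose[OF h0 y0]
        right_linear_compose[OF h y]) auto
  \<comment> \<open>Applying \<open>Z\<close> to \<open>\<eta> x\<close> yields a term in
    \<open>z\<close>, which is a legitimate perturbation, and terms
    \<open>B j l (\<delta> j l (\<eta> x))\<close>, which are absorbed into the right inverse. Since
    \<open>c\<close> annihilates \<open>\<delta>\<close>, recombining a block of \<open>Y'\<close>
    by \<open>c\<close> still gives \<open>y j\<close>.\<close>
  define Y' where "Y' j l x = w l (y j x) + \<delta> j l (\<eta> x)" for j l x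
  \<comment> \<open>Entry 0 is the single copy of P; entry \<open>Suc (j * t + l)\<close> is
    position \<open>l\<close> of block \<open>j\<close>, recovered by \<open>div\<close> and
    \<open>mod\<close>.\<close>
  define Y where "Y i = (case i of 0 \<Rightarrow> y0 | Suc n \<Rightarrow> Y' (n div t) (n mod t))" for i
  define H where "H i = (case i of 0 \<Rightarrow> h0 | Suc n \<Rightarrow> (\<lambda>x. h (n div t) (c (n mod t) x)))" for i
  have Y': "right_linear sp sp (Y' j l)" if "j < r" "l < t" for j l
    unfolding Y'_def[abs_def] using that
    by (intro right_linear_plus sp right_linear_compose[OF w y] right_linear_compose[OF \<delta> \<eta>])
  have divmod: "n div t < r \<and> n mod t < t" if "n < r * t" for n
    using that by (cases "t = 0") (simp_all add: less_mult_imp_div_less)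
  show "\<exists>h y. (\<forall>i<Suc (r * t). right_linear sp sp (h i)) \<and> (\<forall>i<Suc (r * t). right_linear sp sp (y i)) \<and>
      (\<forall>x. (\<Sum>i<Suc (r * t). b i (y i x) + z (h i (y i x))) = x)"
  proof (rule exI[of _ H], rule exI[of _ Y], intro conjI allI impI)
    fix i assume "i < Suc (r * t)"
    then show "right_linear sp sp (H i)" "right_linear sp sp (Y i)"
      using h0 y0 divmod Y' by (auto simp: H_def Y_def split: nat.split intro!: right_linear_compose[OF h c])
  next
    fix x
    have Yx: "Y (Suc (j * t + l)) = Y' j l" and Hx: "H (Suc (j * t + l)) = (\<lambda>x. h j (c l x))"
      if "l < t" for j l
      using that by (simp_all add: Y_def H_def)
    have hc: "(\<Sum>l<t. z (h j (c l (Y' j l x)))) = z (h j (y j x))" if j: "j < r" for j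
    proof -
      have "(\<Sum>l<t. c l (Y' j l x)) = (\<Sum>l<t. c l (w l (y j x)) + c l (\<delta> j l (\<eta> x)))"
        by (rule sum.cong) (simp_all add: Y'_def right_linear_add[OF c])
      then have "(\<Sum>l<t. c l (Y' j l x)) = y j x"
        by (simp add: sum.distrib cw c\<delta>[OF j])
      then show ?thesis
        by (simp flip: right_linear_sum[OF z] right_linear_sum[OF h[OF j]])
    qed
    have BY: "(\<Sum>l<t. B j l (Y' j l x)) = G j (y j x) + (\<Sum>l<t. B j l (\<delta> j l (\<eta> x)))" if "j < r" for j
      unfolding G_def sum.distrib[symmetric]
      by (rule sum.cong) (simp_all add: Y'_def right_linear_add[OF B] that)
    have "(\<Sum>i<Suc (r * t). b i (Y i x) + z (H i (Y i x)))
      = b 0 (y0 x) + z (h0 (y0 x)) + (\<Sum>j<r. \<Sum>l<t. B j l (Y' j l x) + z (h j (c l (Y' j l x))))"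
      unfolding split B_def[symmetric] by (simp add: Yx Hx) (simp add: Y_def H_def)
    also have "(\<Sum>j<r. \<Sum>l<t. B j l (Y' j l x) + z (h j (c l (Y' j l x))))
      = (\<Sum>j<r. G j (y j x) + (\<Sum>l<t. B j l (\<delta> j l (\<eta> x))) + z (h j (y j x)))"
      by (rule sum.cong) (simp_all add: sum.distrib hc BY)
    also have "b 0 (y0 x) + z (h0 (y0 x)) + \<dots> = b 0 (y0 x) + (\<Sum>j<r. G j (y j x)) + Z (\<eta> x)"
      unfolding Z_def \<eta>_def[of x]
      by (simp add: sum.distrib right_linear_add[OF z] right_linear_sum[OF z] algebra_simps)
    also have "\<dots> = x" using hy unfolding \<eta>_def .
    finally show "(\<Sum>i<Suc (r * t). b i (Y i x) + z (H i (Y i x))) = x" .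
  qed
qed

section \<open>Stable rank\<close>

text \<open>A right ideal containing the unit is everything: multiply its coefficients on the right
  by the desired element.\<close>

lemma (in ring) right_unimodular_iff:
  "right_unimodular R n a \<longleftrightarrow> (\<forall>i<n. a i \<in> carrier R) \<and>
     (\<exists>b. (\<forall>i<n. b i \<in> carrier R) \<and> (\<Oplus>i\<in>{..<n}. a i \<otimes> b i) = \<one>)"
proof (intro iffI conjI)
  assume um: "right_unimodular R n a"
  then show "\<forall>i<n. a i \<in> carrier R" by (simp add: right_unimodular_def)
  have "\<one> \<in> {(\<Oplus>i\<in>{..<n}. a i \<otimes> b i) | b. \<forall>i<n. b i \<in> carrier R}"
    using um one_closed unfolding right_unimodular_def by blast
  then obtain b where "\<one> = (\<Oplus>i\<in>{..<n}. a i \<otimes> b i)" "\<forall>i<n. b i \<in> carrier R" by blast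
  then show "\<exists>b. (\<forall>i<n. b i \<in> carrier R) \<and> (\<Oplus>i\<in>{..<n}. a i \<otimes> b i) = \<one>"
    by (intro exI[of _ b]) simp
next
  assume "(\<forall>i<n. a i \<in> carrier R) \<and>
     (\<exists>b. (\<forall>i<n. b i \<in> carrier R) \<and> (\<Oplus>i\<in>{..<n}. a i \<otimes> b i) = \<one>)"
  then obtain b where a: "\<forall>i<n. a i \<in> carrier R" and b: "\<forall>i<n. b i \<in> carrier R"
    and ab: "(\<Oplus>i\<in>{..<n}. a i \<otimes> b i) = \<one>" by blast
  have "x \<in> {(\<Oplus>i\<in>{..<n}. a i \<otimes> b i) | b. \<forall>i<n. b i \<in> carrier R}" if x: "x \<in> carrier R" for x
  proof -
    have "x = (\<Oplus>i\<in>{..<n}. a i \<otimes> b i) \<otimes> x" using x by (simp add: ab)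
    also have "\<dots> = (\<Oplus>i\<in>{..<n}. a i \<otimes> b i \<otimes> x)"
      using x a b by (intro finsum_ldistr) auto
    also have "\<dots> = (\<Oplus>i\<in>{..<n}. a i \<otimes> (b i \<otimes> x))"
      using x a b by (intro finsum_cong') (auto simp: m_assoc)
    finally show ?thesis using x b by (intro CollectI exI[of _ "\<lambda>i. b i \<otimes> x"]) auto
  qed
  moreover have "(\<Oplus>i\<in>{..<n}. a i \<otimes> b i) \<in> carrier R" if "\<forall>i<n. b i \<in> carrier R" for b
    using a that by (intro finsum_closed) auto
  ultimately show "right_unimodular R n a"
    unfolding right_unimodular_def using a by blast
qed

text \<open>From left to right, \<open>z\<close> is taken as last entry with coefficient
  \<open>\<one>\<close>. Conversely \<open>z\<close> is the last entry times its coefficient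
  \<open>b n\<close>, and that factor is moved into the reducing elements.\<close>

lemma (in ring) sr_cond_iff:
  "sr_cond R n \<longleftrightarrow> (\<forall>b a z. (\<forall>i<n. b i \<in> carrier R) \<and> (\<forall>i<n. a i \<in> carrier R) \<and> z \<in> carrier R \<and>
      (\<Oplus>i\<in>{..<n}. b i \<otimes> a i) \<oplus> z = \<one> \<longrightarrow>
      (\<exists>h y. (\<forall>i<n. h i \<in> carrier R) \<and> (\<forall>i<n. y i \<in> carrier R) \<and>
        (\<Oplus>i\<in>{..<n}. (b i \<oplus> z \<otimes> h i) \<otimes> y i) = \<one>))" (is "_ \<longleftrightarrow> ?rhs")
proof
  assume sr: "sr_cond R n"
  show ?rhs
  proof (intro allI impI, elim conjE)
    fix b a z
    assume b: "\<forall>i<n. b i \<in> carrier R" and a: "\<forall>i<n. a i \<in> carrier R" and z: "z \<in> carrier R"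
      and eq: "(\<Oplus>i\<in>{..<n}. b i \<otimes> a i) \<oplus> z = \<one>"
    let ?b = "b(n := z)" and ?a = "a(n := \<one>)"
    have "(\<Oplus>i\<in>{..<Suc n}. ?b i \<otimes> ?a i) = z \<oplus> (\<Oplus>i\<in>{..<n}. ?b i \<otimes> ?a i)"
      using a b z by (simp add: lessThan_Suc Pi_def)
    also have "(\<Oplus>i\<in>{..<n}. ?b i \<otimes> ?a i) = (\<Oplus>i\<in>{..<n}. b i \<otimes> a i)"
      using a b by (intro finsum_cong') auto
    also have "z \<oplus> \<dots> = \<one>" using a b z by (subst a_comm) (auto simp: eq)
    finally have "right_unimodular R (Suc n) ?b"
      unfolding right_unimodular_iff using a b z by (intro conjI exI[of _ ?a]) (auto simp: less_Suc_eq)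
    then obtain c where c: "\<forall>i<n. c i \<in> carrier R"
      and "right_unimodular R n (\<lambda>i. ?b i \<oplus> ?b n \<otimes> c i)"
      using sr unfolding sr_cond_def reducible_row_def by blast
    then obtain y where y: "\<forall>i<n. y i \<in> carrier R"
      and 1: "(\<Oplus>i\<in>{..<n}. (?b i \<oplus> ?b n \<otimes> c i) \<otimes> y i) = \<one>"
      unfolding right_unimodular_iff by blast
    have "(\<Oplus>i\<in>{..<n}. (b i \<oplus> z \<otimes> c i) \<otimes> y i) = (\<Oplus>i\<in>{..<n}. (?b i \<oplus> ?b n \<otimes> c i) \<otimes> y i)"
      using b z c y by (intro finsum_cong') auto
    then have "(\<Oplus>i\<in>{..<n}. (b i \<oplus> z \<otimes> c i) \<otimes> y i) = \<one>" unfolding 1 .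
    with c y show "\<exists>h y. (\<forall>i<n. h i \<in> carrier R) \<and> (\<forall>i<n. y i \<in> carrier R) \<and>
        (\<Oplus>i\<in>{..<n}. (b i \<oplus> z \<otimes> h i) \<otimes> y i) = \<one>" by blast
  qed
next
  assume R: ?rhs
  show "sr_cond R n"
    unfolding sr_cond_def
  proof (intro allI impI)
    fix a assume "right_unimodular R (Suc n) a"
    then obtain b where a: "\<forall>i<Suc n. a i \<in> carrier R" and b: "\<forall>i<Suc n. b i \<in> carrier R"
      and eq: "(\<Oplus>i\<in>{..<Suc n}. a i \<otimes> b i) = \<one>"
      unfolding right_unimodular_iff by blast
    have "(\<Oplus>i\<in>{..<n}. a i \<otimes> b i) \<oplus> a n \<otimes> b n = \<one>"
      using a b eq by (subst a_comm) (auto simp: lessThan_Suc Pi_def)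
    moreover have "\<forall>i<n. a i \<in> carrier R" "\<forall>i<n. b i \<in> carrier R" "a n \<otimes> b n \<in> carrier R"
      using a b by simp_all
    ultimately obtain h y where h: "\<forall>i<n. h i \<in> carrier R" and y: "\<forall>i<n. y i \<in> carrier R"
      and 1: "(\<Oplus>i\<in>{..<n}. (a i \<oplus> a n \<otimes> b n \<otimes> h i) \<otimes> y i) = \<one>"
      using R[THEN spec, of a, THEN spec, of b, THEN spec, of "a n \<otimes> b n"] by blast
    have "(\<Oplus>i\<in>{..<n}. (a i \<oplus> a n \<otimes> (b n \<otimes> h i)) \<otimes> y i) = (\<Oplus>i\<in>{..<n}. (a i \<oplus> a n \<otimes> b n \<otimes> h i) \<otimes> y i)"
      using a b h y by (intro finsum_cong') (auto simp: m_assoc)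
    then have "right_unimodular R n (\<lambda>i. a i \<oplus> a n \<otimes> (b n \<otimes> h i))"
      unfolding right_unimodular_iff 1 using a b h y by (intro conjI exI[of _ y]) simp_all
    then show "reducible_row R n a"
      unfolding reducible_row_def using b h by (intro exI[of _ "\<lambda>i. b n \<otimes> h i"]) auto
  qed
qed

section \<open>Stable rank condition of an endomorphism ring\<close>

lemma End_ring_simps:
  "carrier (End_ring sm) = {f. right_linear sm sm f}"
  "f \<otimes>\<^bsub>End_ring sm\<^esub> g = (\<lambda>x. f (g x))"
  "f \<oplus>\<^bsub>End_ring sm\<^esub> g = (\<lambda>x. f x + g x)"
  "\<one>\<^bsub>End_ring sm\<^esub> = (\<lambda>x. x)"
  "\<zero>\<^bsub>End_ring sm\<^esub> = (\<lambda>x. 0)"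
  by (auto simp: End_ring_def is_endo_iff fun_eq_iff)

lemma ring_End_ring:
  assumes "right_module sm"
  shows "ring (End_ring sm)"
proof (intro ringI abelian_groupI monoidI; simp only: End_ring_simps mem_Collect_eq)
  show "right_linear sm sm (\<lambda>x. x)" by (simp add: right_linear_def)
next
  fix f assume "right_linear sm sm f"
  then show "\<exists>g\<in>{f. right_linear sm sm f}. (\<lambda>x. g x + f x) = (\<lambda>x. 0)"
    using assms by (intro bexI[of _ "\<lambda>x. - f x"]) (simp_all add: right_linear_uminus)
qed (use assms in \<open>auto simp: right_linear_plus right_linear_zero right_linear_compose right_linear_add ac_simps\<close>)

lemma finsum_End_ring:
  assumes "right_module sm" "finite A" "\<And>i. i \<in> A \<Longrightarrow> right_linear sm sm (f i)"
  shows "finsum (End_ring sm) f A = (\<lambda>x. \<Sum>i\<in>A. f i x)"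
proof -
  interpret ring "End_ring sm" by (rule ring_End_ring[OF assms(1)])
  show ?thesis
    using assms(2,3)
    by (induction A rule: finite_induct) (auto simp: End_ring_simps Pi_def)
qed

lemma sr_cond_End_ring:
  assumes sm: "right_module sm"
  shows "sr_cond (End_ring sm) n \<longleftrightarrow> row_cond sm n"
proof -
  interpret ring "End_ring sm" by (rule ring_End_ring[OF sm])
  have 1: "finsum (End_ring sm) (\<lambda>i. \<lambda>x. b i (a i x)) {..<n} = (\<lambda>x. \<Sum>i<n. b i (a i x))"
    if "\<forall>i<n. right_linear sm sm (b i)" "\<forall>i<n. right_linear sm sm (a i)" for a b
    using that by (intro finsum_End_ring sm) (auto intro: right_linear_compose)
  have 2: "finsum (End_ring sm) (\<lambda>i. \<lambda>x. b i (y i x) + z (h i (y i x))) {..<n}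
      = (\<lambda>x. \<Sum>i<n. b i (y i x) + z (h i (y i x)))"
    if "\<forall>i<n. right_linear sm sm (b i)" "\<forall>i<n. right_linear sm sm (h i)" "\<forall>i<n. right_linear sm sm (y i)"
      "right_linear sm sm z" for b y z h
    using that
    by (intro finsum_End_ring right_linear_plus right_linear_compose[OF that(4)] sm)
      (auto intro: right_linear_compose)
  show ?thesis
    unfolding sr_cond_iff row_cond_def End_ring_simps is_endo_iff mem_Collect_eq
  proof (intro iff_allI imp_cong conj_cong refl iff_exI)
    fix b a z
    assume b: "\<forall>i<n. right_linear sm sm (b i)" and a: "\<forall>i<n. right_linear sm sm (a i)"
    show "((\<lambda>x. finsum (End_ring sm) (\<lambda>i x. b i (a i x)) {..<n} x + z x) = (\<lambda>x. x)) \<longleftrightarrow>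
        (\<forall>x. (\<Sum>i<n. b i (a i x)) + z x = x)"
      unfolding 1[OF b a] fun_eq_iff ..
  next
    fix b a z h y
    assume "(\<forall>i<n. right_linear sm sm (b i)) \<and> (\<forall>i<n. right_linear sm sm (a i)) \<and>
        right_linear sm sm z \<and> (\<forall>x. (\<Sum>i<n. b i (a i x)) + z x = x)"
      and h: "\<forall>i<n. right_linear sm sm (h i)" and y: "\<forall>i<n. right_linear sm sm (y i)"
    then have b: "\<forall>i<n. right_linear sm sm (b i)" and z: "right_linear sm sm z" by auto
    show "(finsum (End_ring sm) (\<lambda>i x. b i (y i x) + z (h i (y i x))) {..<n} = (\<lambda>x. x)) \<longleftrightarrow>
        (\<forall>x. (\<Sum>i<n. b i (y i x) + z (h i (y i x))) = x)"
      unfolding 2[OF b h y z] fun_eq_iff ..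
  qed
qed

section \<open>The base ring as endomorphism ring of its regular module\<close>

lemma right_module_times: "right_module ((*) :: 'a::ring_1 \<Rightarrow> 'a \<Rightarrow> 'a)"
  by (simp add: right_module_def algebra_simps)

lemma type_ring_simps:
  "carrier type_ring = UNIV" "x \<otimes>\<^bsub>type_ring\<^esub> y = x * y" "x \<oplus>\<^bsub>type_ring\<^esub> y = x + y"
  "\<one>\<^bsub>type_ring\<^esub> = 1" "\<zero>\<^bsub>type_ring\<^esub> = 0"
  by (simp_all add: type_ring_def)

lemma ring_type_ring: "ring (type_ring :: 'a::ring_1 ring)"
proof (intro ringI abelian_groupI monoidI; simp only: type_ring_simps)
  show "\<exists>y\<in>UNIV. y + x = 0" for x :: 'a by (intro bexI[of _ "- x"]) simp_all
qed (auto simp: algebra_simps)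

lemma finsum_type_ring: "finite A \<Longrightarrow> finsum type_ring f A = sum f A" for f :: "'b \<Rightarrow> 'a::ring_1"
proof -
  interpret ring "type_ring :: 'a ring" by (rule ring_type_ring)
  show "finite A \<Longrightarrow> finsum type_ring f A = sum f A"
    by (induction A rule: finite_induct) (auto simp: type_ring_simps)
qed

text \<open>Linearity applied to \<open>1 * x\<close>; this identifies the ring with the
  endomorphisms of its regular right module.\<close>

lemma endo_times_eq: "is_endo (*) f \<Longrightarrow> f x = f 1 * x" for f :: "'a::ring_1 \<Rightarrow> 'a"
  unfolding is_endo_def by (metis mult_1)

lemma is_endo_times: "is_endo (*) (\<lambda>x. c * x)" for c :: "'a::ring_1"
  by (simp add: is_endo_def algebra_simps)

text \<open>Endomorphisms are exchanged for their values at 1 and ring elements for left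
  multiplications.\<close>

lemma sr_cond_type_ring: "sr_cond (type_ring :: 'a::ring_1 ring) n \<longleftrightarrow> row_cond ((*) :: 'a \<Rightarrow> 'a \<Rightarrow> 'a) n"
proof -
  interpret ring "type_ring :: 'a ring" by (rule ring_type_ring)
  have sr_iff: "sr_cond (type_ring :: 'a ring) n \<longleftrightarrow>
    (\<forall>(b :: nat \<Rightarrow> 'a) a z. (\<Sum>i<n. b i * a i) + z = 1 \<longrightarrow> (\<exists>h y. (\<Sum>i<n. (b i + z * h i) * y i) = 1))"
    unfolding sr_cond_iff by (simp add: type_ring_simps finsum_type_ring)
  show ?thesis
  proof
    assume sr: "sr_cond (type_ring :: 'a ring) n"
    show "row_cond ((*) :: 'a \<Rightarrow> 'a \<Rightarrow> 'a) n"
      unfolding row_cond_def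
    proof (intro allI impI, elim conjE)
      fix b a :: "nat \<Rightarrow> 'a \<Rightarrow> 'a" and z :: "'a \<Rightarrow> 'a"
      assume b: "\<forall>i<n. is_endo (*) (b i)" and a: "\<forall>i<n. is_endo (*) (a i)" and z: "is_endo (*) z"
        and eq: "\<forall>x. (\<Sum>i<n. b i (a i x)) + z x = x"
      have b': "b i x = b i 1 * x" if "i < n" for i x using b that endo_times_eq by blast
      have z': "z x = z 1 * x" for x using z endo_times_eq by blast
      have "(\<Sum>i<n. b i (a i 1)) = (\<Sum>i<n. b i 1 * a i 1)"
        by (rule sum.cong) (auto intro: b')
      then have "(\<Sum>i<n. b i 1 * a i 1) + z 1 = 1" using eq[rule_format, of 1] by simp
      then obtain h y where hy: "(\<Sum>i<n. (b i 1 + z 1 * h i) * y i) = 1"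
        using sr[unfolded sr_iff, THEN spec, of "\<lambda>i. b i 1", THEN spec, of "\<lambda>i. a i 1", THEN spec, of "z 1"]
        by blast
      have "(\<Sum>i<n. b i (y i * x) + z (h i * (y i * x))) = x" for x
      proof -
        have "(\<Sum>i<n. b i (y i * x) + z (h i * (y i * x))) = (\<Sum>i<n. (b i 1 + z 1 * h i) * y i) * x"
          unfolding sum_distrib_right
          by (rule sum.cong) (simp_all add: b'[of _ "y _ * x"] z'[of "h _ * _"] algebra_simps)
        then show ?thesis by (simp add: hy)
      qed
      then show "\<exists>h y. (\<forall>i<n. is_endo (*) (h i)) \<and> (\<forall>i<n. is_endo (*) (y i)) \<and>
          (\<forall>x. (\<Sum>i<n. b i (y i x) + z (h i (y i x))) = x)"
        by - (rule exI[of _ "\<lambda>i x. h i * x"], rule exI[of _ "\<lambda>i x. y i * x"], simp add: is_endo_times)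
    qed
  next
    assume row: "row_cond ((*) :: 'a \<Rightarrow> 'a \<Rightarrow> 'a) n"
    show "sr_cond (type_ring :: 'a ring) n"
      unfolding sr_iff
    proof (intro allI impI)
      fix b a :: "nat \<Rightarrow> 'a" and z :: 'a
      assume eq: "(\<Sum>i<n. b i * a i) + z = 1"
      have row_eq: "(\<Sum>i<n. b i * (a i * x)) + z * x = x" for x
      proof -
        have "(\<Sum>i<n. b i * (a i * x)) + z * x = ((\<Sum>i<n. b i * a i) + z) * x"
          by (simp add: sum_distrib_right distrib_right mult.assoc)
        then show ?thesis by (simp add: eq)
      qed
      obtain h y where h: "\<forall>i<n. is_endo (*) (h i)"
        and "\<And>x. (\<Sum>i<n. b i * y i x + z * h i (y i x)) = x"
        by (rule row_condE[OF row, of "\<lambda>i x. b i * x" "\<lambda>i x. a i * x" "\<lambda>x. z * x",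
              OF is_endo_times is_endo_times is_endo_times row_eq]) (rule that)
      then have "(\<Sum>i<n. b i * y i 1 + z * h i (y i 1)) = 1" by blast
      also have "(\<Sum>i<n. b i * y i 1 + z * h i (y i 1)) = (\<Sum>i<n. (b i + z * h i 1) * y i 1)"
      proof (rule sum.cong)
        fix i assume "i \<in> {..<n}"
        then have "h i (y i 1) = h i 1 * y i 1" using h endo_times_eq by blast
        then show "b i * y i 1 + z * h i (y i 1) = (b i + z * h i 1) * y i 1"
          by (simp add: algebra_simps)
      qed simp
      finally show "\<exists>h y. (\<Sum>i<n. (b i + z * h i) * y i) = 1"
        by (rule exI[of _ "\<lambda>i. h i 1", OF exI[of _ "\<lambda>i. y i 1"]])
    qed
  qed
qed

section \<open>Numerical bound, dual bases and the two inequalities\<close>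

lemma stable_rank_le:
  assumes t: "t > 0" and transfer: "\<And>r. sr_cond S (Suc r) \<Longrightarrow> sr_cond R (Suc (r * t))"
  shows "stable_rank R \<le> enat t * stable_rank S - enat t + 1"
proof (cases "\<exists>n\<ge>1. sr_cond S n")
  case True
  define s where "s = (LEAST n. n \<ge> 1 \<and> sr_cond S n)"
  have s: "s \<ge> 1 \<and> sr_cond S s" unfolding s_def by (rule LeastI_ex[OF True])
  \<comment> \<open>The least rank is positive, hence \<open>Suc r\<close>, and
    \<open>r * t + 1\<close> equals \<open>t * Suc r - t + 1\<close>.\<close>
  then obtain r where r: "s = Suc r" by (cases s) auto
  have R: "sr_cond R (Suc (r * t))" using s transfer unfolding r by blast
  then have "\<exists>n\<ge>1. sr_cond R n" by (intro exI[of _ "Suc (r * t)"]) simp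
  then have "stable_rank R = enat (LEAST n. n \<ge> 1 \<and> sr_cond R n)"
    unfolding stable_rank_def by (rule if_P)
  also have "\<dots> \<le> enat (Suc (r * t))"
    unfolding enat_ord_simps by (rule Least_le) (simp add: R)
  finally have "stable_rank R \<le> enat (Suc (r * t))" .
  moreover have "stable_rank S = enat (Suc r)"
    unfolding stable_rank_def if_P[OF True] s_def[symmetric] r ..
  ultimately show ?thesis by (simp add: one_enat_def mult.commute)
next
  case False
  then have "stable_rank S = \<infinity>" unfolding stable_rank_def by (rule if_not_P)
  \<comment> \<open>Positivity of \<open>t\<close> matters: in \<open>enat\<close> zero times
    infinity is zero.\<close>
  moreover have "enat t * \<infinity> = \<infinity>" using t by (simp add: imult_is_infinity enat_0_iff)
  ultimately show ?thesis by simp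
qed

text \<open>The basis elements are the images of the unit vectors under \<open>\<pi>\<close>, and
  the dual functionals are the coordinates of \<open>\<iota>\<close>.\<close>

lemma fg_projective_dual_basis:
  assumes "fg_projective sm"
  obtains m p \<phi> where "\<And>i. right_linear sm (*) (\<phi> i)" "\<And>x. (\<Sum>i<(m::nat). sm (p i) (\<phi> i x)) = x"
proof -
  obtain m \<iota> \<pi> where \<iota>: "\<And>x. \<iota> x \<in> free_vecs m"
    "\<And>x y. \<iota> (x + y) = (\<lambda>i. \<iota> x i + \<iota> y i)" "\<And>x a. \<iota> (sm x a) = (\<lambda>i. \<iota> x i * a)"
    and \<pi>: "\<And>v w. v \<in> free_vecs m \<Longrightarrow> w \<in> free_vecs m \<Longrightarrow> \<pi> (\<lambda>i. v i + w i) = \<pi> v + \<pi> w"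
    "\<And>v a. v \<in> free_vecs m \<Longrightarrow> \<pi> (\<lambda>i. v i * a) = sm (\<pi> v) a"
    and \<pi>\<iota>: "\<And>x. \<pi> (\<iota> x) = x"
    using assms unfolding fg_projective_def by blast
  \<comment> \<open>Coordinates are added one at a time; \<open>k \<le> m\<close> keeps the vectors
    in \<open>free_vecs m\<close>, the domain on which \<open>\<pi>\<close> is known to be
    linear.\<close>
  have expand: "\<pi> (\<lambda>j. if j < k then f j else 0) = (\<Sum>i<k. sm (\<pi> (single i 1)) (f i))" if "k \<le> m" for k f
    using that
  proof (induction k)
    case 0
    show ?case using \<pi>(1)[of "\<lambda>_. 0" "\<lambda>_. 0"] by (simp add: free_vecs_def)
  next
    case (Suc k)
    have "(\<lambda>j. if j < Suc k then f j else 0) = (\<lambda>j. (if j < k then f j else 0) + single k 1 j * f k)"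
      by (auto simp: single_def less_Suc_eq)
    then have "\<pi> (\<lambda>j. if j < Suc k then f j else 0) = \<pi> (\<lambda>j. (if j < k then f j else 0) + single k 1 j * f k)"
      by simp
    also have "\<dots> = \<pi> (\<lambda>j. if j < k then f j else 0) + \<pi> (\<lambda>j. single k 1 j * f k)"
      using Suc.prems by (intro \<pi>) (auto simp: free_vecs_def single_def)
    also have "\<pi> (\<lambda>j. single k 1 j * f k) = sm (\<pi> (single k 1)) (f k)"
      using Suc.prems by (intro \<pi>) (auto simp: free_vecs_def single_def)
    finally show ?case using Suc by simp
  qed
  have "(\<lambda>j. if j < m then \<iota> x j else 0) = \<iota> x" for x
    using \<iota>(1)[of x] by (auto simp: free_vecs_def fun_eq_iff)
  then have "(\<Sum>i<m. sm (\<pi> (single i 1)) (\<iota> x i)) = x" for x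
    using expand[OF order_refl, of "\<iota> x"] by (simp add: \<pi>\<iota>)
  moreover have "right_linear sm (*) (\<lambda>x. \<iota> x i)" for i
    by (simp add: right_linear_def \<iota>)
  ultimately show thesis by (intro that[of "\<lambda>i x. \<iota> x i" "\<lambda>i. \<pi> (single i 1)" m])
qed

lemma right_linear_smul: "right_module sm \<Longrightarrow> right_linear (*) sm (sm p)"
  by (simp add: right_module_def right_linear_def)

theorem theorem9:
  fixes smul :: "'p::ab_group_add \<Rightarrow> 'a::ring_1 \<Rightarrow> 'p"
  assumes "right_module smul"
    and "fg_projective smul"
    and "generator smul"
  shows "(\<forall>n. generated_by smul n \<longrightarrow>
            stable_rank (type_ring :: 'a ring)
              \<le> enat n * stable_rank (End_ring smul) - enat n + 1)
       \<and> (\<forall>(t::nat) (f :: nat \<Rightarrow> 'p \<Rightarrow> 'a).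
            (\<forall>i<t. hom_to_A smul (f i)) \<and> (\<forall>a. \<exists>x. a = (\<Sum>i<t. f i (x i))) \<longrightarrow>
            stable_rank (End_ring smul)
              \<le> enat t * stable_rank (type_ring :: 'a ring) - enat t + 1)"
proof -
  note sm = assms(1)
  obtain m p \<phi> where \<phi>: "\<And>i. right_linear smul (*) (\<phi> i)" and p\<phi>: "\<And>x. (\<Sum>i<(m::nat). smul (p i) (\<phi> i x)) = x"
    by (rule fg_projective_dual_basis[OF assms(2)]) (rule that)
  \<comment> \<open>One expression of 1 gives a linear section: \<open>a\<close> is sent to the
    tuple of the \<open>smul (x i) a\<close>. Thus A becomes a summand of P^k.\<close>
  have surj: "(\<Sum>i<k. g i (smul (x i) a)) = a"
    if "\<forall>i<k. hom_to_A smul (g i)" "1 = (\<Sum>i<k. g i (x i))" for k :: nat and g x a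
  proof -
    have "(\<Sum>i<k. g i (smul (x i) a)) = (\<Sum>i<k. g i (x i)) * a"
      unfolding sum_distrib_right using that(1) by (intro sum.cong) (auto simp: hom_to_A_def)
    then show ?thesis using that(2) by simp
  qed
  obtain k g x where g: "\<forall>i<k. hom_to_A smul (g i)" and gx: "1 = (\<Sum>i<(k::nat). g i (x i))"
    using assms(3) unfolding generator_def by blast
  have k: "k > 0" using gx by (cases k) auto
  \<comment> \<open>In \<open>ring_1\<close> one has \<open>1 \<noteq> 0\<close>, while linear maps
    on a zero module vanish. Hence P is nonzero, which makes the lengths \<open>m\<close> and
    \<open>n\<close> positive.\<close>
  have nonzero: "\<exists>y :: 'p. y \<noteq> 0"
  proof (rule ccontr)
    assume "\<not> ?thesis"
    then have "g i (x i) = 0" if "i < k" for i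
      using g that by (metis hom_to_A_iff right_linear_0)
    then show False using gx by simp
  qed
  have m: "m > 0" using nonzero p\<phi> by (cases m) auto
  have gen: "stable_rank (type_ring :: 'a ring) \<le> enat n * stable_rank (End_ring smul) - enat n + 1"
    if gen_n: "generated_by smul n" for n
  proof -
    obtain p' where "\<forall>x. \<exists>a. x = (\<Sum>i<n. smul (p' i) (a i))"
      using gen_n unfolding generated_by_def by blast
    then obtain a where a: "\<And>x. x = (\<Sum>i<n. smul (p' i) (a x i))" by metis
    \<comment> \<open>The chosen coefficients \<open>a x\<close> need not be linear in
      \<open>x\<close>. Using them only at the elements \<open>p j\<close> and extending along
      \<open>\<phi>\<close> gives a linear section of the surjection from A^n to P.\<close>
    define w where "w i x = (\<Sum>j<m. a (p j) i * \<phi> j x)" for i x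
    have w: "right_linear smul (*) (w i)" for i
      unfolding w_def[abs_def]
      by (intro right_linear_sum_fun right_module_times
          right_linear_compose[OF right_linear_smul[OF right_module_times] \<phi>])
    have "(\<Sum>i<n. smul (p' i) (w i x)) = x" for x
    proof -
      have "(\<Sum>i<n. smul (p' i) (w i x)) = (\<Sum>i<n. \<Sum>j<m. smul (smul (p' i) (a (p j) i)) (\<phi> j x))"
        unfolding w_def using sm by (simp add: right_linear_sum[OF right_linear_smul[OF sm]] right_module_def)
      also have "\<dots> = (\<Sum>j<m. \<Sum>i<n. smul (smul (p' i) (a (p j) i)) (\<phi> j x))"
        by (rule sum.swap)
      also have "\<dots> = (\<Sum>j<m. smul (\<Sum>i<n. smul (p' i) (a (p j) i)) (\<phi> j x))"
      proof (rule sum.cong)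
        have "smul (sum f A) c = (\<Sum>i\<in>A. smul (f i) c)" for f :: "nat \<Rightarrow> 'p" and A c
          using sm by (induction A rule: infinite_finite_induct) (simp_all add: right_module_0 right_module_def)
        then show "(\<Sum>i<n. smul (smul (p' i) (a (p j) i)) (\<phi> j x)) =
            smul (\<Sum>i<n. smul (p' i) (a (p j) i)) (\<phi> j x)" for j by simp
      qed simp
      finally show ?thesis by (simp add: p\<phi> flip: a)
    qed
    note pw = this
    have n: "n > 0" using nonzero pw by (cases n) auto
    show ?thesis
    proof (rule stable_rank_le[OF n])
      fix r assume "sr_cond (End_ring smul) (Suc r)"
      then have "row_cond smul (Suc r)" by (simp add: sr_cond_End_ring[OF sm])
      \<comment> \<open>The condition passes from P to A: A is a summand of P^k by \<open>g\<close>,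
        and P is a summand of A^n by \<open>w\<close>.\<close>
      then have "row_cond ((*) :: 'a \<Rightarrow> 'a \<Rightarrow> 'a) (Suc (r * n))"
        using g surj[OF g gx] k w pw
        by (intro row_cond_transfer[where u = "\<lambda>i. smul (x i)" and v = g and m = k and w = w and c = "\<lambda>i. smul (p' i)"])
          (auto simp: hom_to_A_iff right_linear_smul[OF sm] right_module_times sm)
      then show "sr_cond (type_ring :: 'a ring) (Suc (r * n))" by (simp add: sr_cond_type_ring)
    qed
  qed
  have dual: "stable_rank (End_ring smul) \<le> enat t * stable_rank (type_ring :: 'a ring) - enat t + 1"
    if f: "\<forall>i<t. hom_to_A smul (f i)" and onto: "\<forall>a. \<exists>x. a = (\<Sum>i<t. f i (x i))" for t and f :: "nat \<Rightarrow> 'p \<Rightarrow> 'a"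
  proof -
    obtain y where fy: "1 = (\<Sum>i<t. f i (y i))" using onto by blast
    have t: "t > 0" using fy by (cases t) auto
    show ?thesis
    proof (rule stable_rank_le[OF t])
      fix r assume "sr_cond (type_ring :: 'a ring) (Suc r)"
      then have "row_cond ((*) :: 'a \<Rightarrow> 'a \<Rightarrow> 'a) (Suc r)" by (simp add: sr_cond_type_ring)
      \<comment> \<open>The roles are exchanged: the dual basis makes P a summand of A^m, and the
        maps \<open>f\<close> make A a summand of P^t.\<close>
      then have "row_cond smul (Suc (r * t))"
        using f surj[OF f fy] m \<phi> p\<phi>
        by (intro row_cond_transfer[where u = \<phi> and v = "\<lambda>i. smul (p i)" and m = m and w = "\<lambda>i. smul (y i)" and c = f])
          (auto simp: hom_to_A_iff right_linear_smul[OF sm] right_module_times sm)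
      then show "sr_cond (End_ring smul) (Suc (r * t))" by (simp add: sr_cond_End_ring[OF sm])
    qed
  qed
  show ?thesis using gen dual by blast
qed

end
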